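(* Let $k$ be an algebraically closed field of characteristic zero, and let $f(y,y')=\sum_{i=0}^n a_i(y)y'^i\in k(t)[y,y']$, with $a_i(y)\in k(t)[y]$ and $n=\deg(f,y')\ge 1$, be an irreducible first order differential polynomial, i.e. $f$ is irreducible over $k(t)$ as a polynomial in the two variables $y,y'$. Assume that $$\ell=\operatorname{m.s.index}(f)=\max_{0\le i\le n}\{\deg(a_i)-2(n-i)\}>0,$$ where $\deg(a_i)$ is the degree of $a_i$ in $y$. Put $\rho=\operatorname{tdeg}(f)$. If $r(t)\in k(t)$ is a rational solution of $f(y,y')=0$ with $\deg(r(t))\ge 1$, then $$\deg(r(t))\leq (2\rho)^{(2\rho)^{15}}\,\mathfrak{h}(f).$$
   Context: $k(t)$ is the field of rational functions in $t$ over $k$, with derivation $'=\mathrm{d}/\mathrm{d}t$. For $f\in k(t)[y,y']$, the symbols $y,y'$ are regarded as two independent variables; $\deg(f,y')$ is the partial degree in $y'$ and $\operatorname{tdeg}(f)$ is the total degree of $f$ in $y,y'$. In the definition of $\operatorname{m.s.index}(f)$, zero coefficients $a_i$ are ignored ($\deg 0=-\infty$). A rational solution of $f(y,y')=0$ is an $r(t)\in k(t)$ with $f(r(t),r'(t))=0$. For $r\in k(t)$ written as a quotient of coprime polynomials, $\deg(r)$ is the maximum of the degrees of numerator and denominator. Height of a polynomial: for $(a_0,\dots,a_m)\in k(t)^{m+1}$ not all zero, put $\mathfrak{h}((a_0:\dots:a_m))=\sum_{\mathfrak p}\max_{0\le i\le m}\{-\operatorname{ord}_{\mathfrak p}(a_i)\}$,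 where $\mathfrak p$ ranges over all places of $k(t)$ over $k$ (i.e. the points $c\in k$, with $\operatorname{ord}_{c}$ the order of vanishing at $t=c$, and the point at infinity, with $\operatorname{ord}_\infty(g/h)=\deg h-\deg g$), and $\operatorname{ord}_{\mathfrak p}(0)=\infty$. This does not depend on the choice of homogeneous coordinates. For a nonzero polynomial $f$ over $k(t)$, $\mathfrak{h}(f)=0$ if $f$ has exactly one term, and otherwise $\mathfrak{h}(f)$ is the height of the projective point whose coordinates are the coefficients of $f$. *)

theory Defs
  imports
    "HOL-Computational_Algebra.Computational_Algebra"
    "HOL-Library.Groups_Big_Fun"
begin

text \<open>
  The field \<open>k(t)\<close> is rendered as \<open>'k poly fract\<close>, and \<open>k(t)[y,y']\<close> as
  \<open>'k poly fract poly poly\<close>: the outer variable is \<open>y'\<close> and the inner one is \<open>y\<close>, so that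
  \<open>coeff f i\<close> is the coefficient \<open>a\<^sub>i(y)\<close> of \<open>y'\<^sup>i\<close> and \<open>degree f\<close> is the partial degree of
  \<open>f\<close> in \<open>y'\<close>.
\<close>

type_synonym 'k ratfun = "'k poly fract"


subsection \<open>Derivation and degree of a rational function\<close>

text \<open>
  \<open>rep_fract\<close> picks an arbitrary representative; the lemmas \<open>ratfun_deriv_Fract\<close> and
  \<open>ratfun_ord_Fract\<close> show that the choice does not matter.
\<close>

definition ratfun_deriv :: "'k::field ratfun \<Rightarrow> 'k ratfun" where
  "ratfun_deriv r = (case rep_fract r of (p, q) \<Rightarrow> Fract (pderiv p * q - p * pderiv q) (q * q))"

lemma rep_fract_Fract:
  fixes p q :: "'a::idom"
  assumes "q \<noteq> 0"
  obtains p' q' where "rep_fract (Fract p q) = (p', q')" "q' \<noteq> 0" "p' * q = p * q'"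
proof -
  have "fractrel (rep_fract (abs_fract (p, q))) (p, q)"
    by (rule Quotient3_rep_abs[OF Quotient3_fract]) (use assms in simp)
  moreover have "Fract p q = abs_fract (p, q)" using assms by (simp add: Fract.abs_eq Fract_def)
  ultimately have "fractrel (rep_fract (Fract p q)) (p, q)" by simp
  then show ?thesis using that by (cases "rep_fract (Fract p q)") auto
qed

lemma ratfun_deriv_Fract:
  assumes "q \<noteq> 0"
  shows "ratfun_deriv (Fract p q) = Fract (pderiv p * q - p * pderiv q) (q * q)"
proof -
  obtain p' q' where rep: "rep_fract (Fract p q) = (p', q')"
    and q': "q' \<noteq> 0" and "p' * q = p * q'" using rep_fract_Fract[OF assms] .
  then have eq: "p * q' = p' * q" by simp
  have "pderiv (p * q') = pderiv (p' * q)" by (simp add: eq)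
  then have d: "p * pderiv q' + q' * pderiv p = p' * pderiv q + q * pderiv p'"
    by (simp add: pderiv_mult)
  have "(pderiv p * q - p * pderiv q) * (q' * q')
      = q * q' * (p * pderiv q' + q' * pderiv p) - q * pderiv q' * (p * q')
        - q' * pderiv q * (p * q')"
    by (simp add: algebra_simps)
  also have "\<dots> = q * q' * (p' * pderiv q + q * pderiv p') - q * pderiv q' * (p' * q)
        - q' * pderiv q * (p' * q)"
    by (simp only: d eq)
  also have "\<dots> = (pderiv p' * q' - p' * pderiv q') * (q * q)"
    by (simp add: algebra_simps)
  finally show ?thesis using assms q' by (simp add: ratfun_deriv_def rep eq_fract)
qed

definition ratfun_degree :: "'k::field ratfun \<Rightarrow> nat" where
  "ratfun_degree r =
     (THE d. \<exists>p q. q \<noteq> 0 \<and> coprime p q \<and> r = Fract p q \<and> d = max (degree p) (degree q))"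

text \<open>
  The library's gcd on polynomials is not available over an arbitrary type of class \<open>field\<close>, so
  the facts showing that \<open>ratfun_degree\<close> is well defined go through Bezout's identity.
\<close>

lemma field_poly_bezout:
  fixes p q :: "'k::field poly"
  assumes "q \<noteq> 0"
  obtains d p' q' u v where "p = d * p'" "q = d * q'" "u * p' + v * q' = 1"
proof -
  define I where "I = {d. d \<noteq> 0 \<and> (\<exists>u v. d = u * p + v * q)}"
  have "q = 0 * p + 1 * q" by simp
  then have "q \<in> I" unfolding I_def using assms by blast
  then obtain d where d: "d \<in> I" and min: "\<And>e. e \<in> I \<Longrightarrow> degree d \<le> degree e"
    using ex_has_least_nat[of "\<lambda>d. d \<in> I" q degree] by blast
  from d obtain u v where d0: "d \<noteq> 0" and duv: "d = u * p + v * q" by (auto simp: I_def)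
  have "d dvd a * p + b * q" for a b
  proof (rule ccontr)
    assume "\<not> d dvd a * p + b * q"
    define e where "e = (a * p + b * q) mod d"
    have e0: "e \<noteq> 0" using \<open>\<not> d dvd _\<close> by (simp add: e_def dvd_eq_mod_eq_0)
    define m where "m = (a * p + b * q) div d"
    have "e = (a * p + b * q) - m * d"
      by (simp only: e_def m_def minus_div_mult_eq_mod)
    also have "\<dots> = (a * p + b * q) - m * (u * p + v * q)" by (simp only: duv)
    also have "\<dots> = (a - m * u) * p + (b - m * v) * q"
      by (simp only: algebra_simps)
    finally have "e \<in> I" using e0 unfolding I_def by blast
    then have "degree d \<le> degree e" by (rule min)
    moreover have "degree e < degree d" unfolding e_def using d0 e0[unfolded e_def]
      by (rule degree_mod_less')
    ultimately show False by simp
  qed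
  from this[of 1 0] this[of 0 1] have "d dvd p" "d dvd q" by simp_all
  then obtain p' q' where pq: "p = d * p'" "q = d * q'" by (auto elim!: dvdE)
  have "d * (u * p' + v * q') = u * p + v * q" by (simp add: pq algebra_simps)
  also have "\<dots> = d * 1" by (simp only: duv[symmetric] mult_1_right)
  finally have "d * (u * p' + v * q') = d * 1" .
  then have "u * p' + v * q' = 1" using d0 by (metis mult_left_cancel)
  with pq show ?thesis by (rule that)
qed

lemma ratfun_coprime_cases:
  fixes r :: "'k::field ratfun"
  obtains p q where "q \<noteq> 0" "coprime p q" "r = Fract p q"
proof -
  obtain a b where r: "r = Fract a b" and b: "b \<noteq> 0" by (cases r) auto
  obtain d p q u v where *: "a = d * p" "b = d * q" "u * p + v * q = 1"
    using field_poly_bezout[OF b] .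
  have "c dvd 1" if "c dvd p" "c dvd q" for c
    using that *(3) by (metis dvd_add dvd_mult)
  then have "coprime p q" by (intro coprimeI) auto
  moreover have "r = Fract p q" using b unfolding r *(1,2) by (intro mult_fract_cancel) auto
  moreover have "q \<noteq> 0" using b * by auto
  ultimately show ?thesis by (intro that)
qed

lemma field_poly_coprime_dvd_mult:
  fixes p q c :: "'k::field poly"
  assumes "coprime p q" "q \<noteq> 0" "q dvd p * c"
  shows "q dvd c"
proof -
  obtain d p' q' u v where *: "p = d * p'" "q = d * q'" "u * p' + v * q' = 1"
    using field_poly_bezout[OF assms(2)] .
  have "d dvd 1" using assms(1) * by (metis coprime_common_divisor dvd_triv_left)
  then obtain e where e: "1 = d * e" by (rule dvdE)
  have "c = c * e * d * (u * p' + v * q')" using *(3) e by (simp add: ac_simps)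
  also have "\<dots> = e * u * (p * c) + c * e * v * q" by (simp add: *(1,2) algebra_simps)
  also have "q dvd \<dots>" using assms(3) by (rule dvd_add[OF dvd_mult dvd_triv_right])
  finally show ?thesis .
qed

lemma ratfun_degree_Fract:
  fixes p q :: "'k::field poly"
  assumes "coprime p q" "q \<noteq> 0"
  shows "ratfun_degree (Fract p q) = max (degree p) (degree q)"
  unfolding ratfun_degree_def
proof (rule the_equality)
  fix d assume "\<exists>p' q'. q' \<noteq> 0 \<and> coprime p' q' \<and> Fract p q = Fract p' q'
      \<and> d = max (degree p') (degree q')"
  then obtain p' q' where *: "q' \<noteq> 0" "coprime p' q'" "Fract p q = Fract p' q'"
    and d: "d = max (degree p') (degree q')" by blast
  from * assms have eq: "p * q' = p' * q" by (simp add: eq_fract)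
  have "q dvd q'"
    using assms by (rule field_poly_coprime_dvd_mult) (simp only: eq dvd_triv_right)
  moreover have "q' dvd q"
    using *(2,1) by (rule field_poly_coprime_dvd_mult) (simp only: eq[symmetric] dvd_triv_right)
  ultimately have dq: "degree q = degree q'" using *(1) assms(2)
    by (intro antisym dvd_imp_degree_le) auto
  have "degree p = degree p'"
  proof (cases "p = 0 \<or> p' = 0")
    case True
    with eq *(1) assms(2) show ?thesis by auto
  next
    case False
    with eq *(1) assms(2) dq show ?thesis by (metis add_right_cancel degree_mult_eq)
  qed
  with dq show "d = max (degree p) (degree q)" by (simp add: d)
qed (use assms in blast)


subsection \<open>Places of \<open>k(t)\<close> and heights\<close>

datatype 'k place = Finite_place 'k | Infinite_place

primrec poly_ord :: "'k::field place \<Rightarrow> 'k poly \<Rightarrow> int" where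
  "poly_ord (Finite_place c) p = int (order c p)"
| "poly_ord Infinite_place p = - int (degree p)"

lemma poly_ord_mult: "p \<noteq> 0 \<Longrightarrow> q \<noteq> 0 \<Longrightarrow> poly_ord P (p * q) = poly_ord P p + poly_ord P q"
  by (cases P) (simp_all add: order_mult degree_mult_eq)

text \<open>
  The order of \<open>0\<close> is \<open>\<infinity>\<close> mathematically; here it is given the junk value \<open>0\<close>,
  and vanishing coordinates, which contribute \<open>-\<infinity>\<close> to the maximum, are left out explicitly
  in the height below.
\<close>

definition ratfun_ord :: "'k::field place \<Rightarrow> 'k ratfun \<Rightarrow> int" where
  "ratfun_ord P r = (if r = 0 then 0 else case rep_fract r of (p, q) \<Rightarrow> poly_ord P p - poly_ord P q)"

lemma ratfun_ord_Fract:
  assumes "p \<noteq> 0" "q \<noteq> 0"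
  shows "ratfun_ord P (Fract p q) = poly_ord P p - poly_ord P q"
proof -
  obtain p' q' where rep: "rep_fract (Fract p q) = (p', q')"
    and q': "q' \<noteq> 0" and eq: "p' * q = p * q'" using rep_fract_Fract[OF assms(2)] .
  have "p' \<noteq> 0" using assms q' eq by auto
  then have "poly_ord P p' + poly_ord P q = poly_ord P p + poly_ord P q'"
    using poly_ord_mult[of p' q P] poly_ord_mult[of p q' P] assms q' eq by simp
  moreover have "Fract p q \<noteq> 0" using assms by (simp add: fract_expand(1) eq_fract)
  ultimately show ?thesis by (simp add: ratfun_ord_def rep)
qed

text \<open>Height of the projective point with coordinates \<open>a\<close>, indexed by the finite set \<open>I\<close>.\<close>

definition point_height :: "'i set \<Rightarrow> ('i \<Rightarrow> 'k::field ratfun) \<Rightarrow> int" where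
  "point_height I a = Sum_any (\<lambda>P. Max ((\<lambda>i. - ratfun_ord P (a i)) ` {i \<in> I. a i \<noteq> 0}))"

text \<open>
  \<open>Sum_any\<close> is \<open>0\<close> by convention on functions with infinite support; this never happens here.
\<close>

lemma finite_ratfun_ord_support: "finite {P. ratfun_ord P r \<noteq> 0}"
proof (cases "r = 0")
  case True
  then show ?thesis by (simp add: ratfun_ord_def)
next
  case False
  then obtain p q where r: "r = Fract p q" "q \<noteq> 0" "p \<noteq> 0"
    by (cases r rule: Fract_cases_nonzero) auto
  have "{P. ratfun_ord P r \<noteq> 0}
      \<subseteq> insert Infinite_place (Finite_place ` ({c. poly p c = 0} \<union> {c. poly q c = 0}))"
  proof
    fix P assume "P \<in> {P. ratfun_ord P r \<noteq> 0}"
    with r show "P \<in> insert Infinite_place (Finite_place ` ({c. poly p c = 0} \<union> {c. poly q c = 0}))"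
      by (cases P) (auto simp: ratfun_ord_Fract order_root)
  qed
  then show ?thesis by (rule finite_subset) (use r in \<open>auto intro: poly_roots_finite\<close>)
qed

lemma finite_point_height_support:
  assumes "finite I" "\<exists>i\<in>I. a i \<noteq> 0"
  shows "finite {P. Max ((\<lambda>i. - ratfun_ord P (a i)) ` {i \<in> I. a i \<noteq> 0}) \<noteq> 0}"
proof (rule finite_subset)
  show "{P. Max ((\<lambda>i. - ratfun_ord P (a i)) ` {i \<in> I. a i \<noteq> 0}) \<noteq> 0}
      \<subseteq> (\<Union>i\<in>I. {P. ratfun_ord P (a i) \<noteq> 0})"
  proof
    fix P assume "P \<in> {P. Max ((\<lambda>i. - ratfun_ord P (a i)) ` {i \<in> I. a i \<noteq> 0}) \<noteq> 0}"
    then have 0: "Max ((\<lambda>i. - ratfun_ord P (a i)) ` {i \<in> I. a i \<noteq> 0}) \<noteq> 0" by simp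
    show "P \<in> (\<Union>i\<in>I. {P. ratfun_ord P (a i) \<noteq> 0})"
    proof (rule ccontr)
      assume "P \<notin> (\<Union>i\<in>I. {P. ratfun_ord P (a i) \<noteq> 0})"
      then have "(\<lambda>i. - ratfun_ord P (a i)) ` {i \<in> I. a i \<noteq> 0} = {0}"
        using assms(2) by (auto simp: image_iff)
      with 0 show False by simp
    qed
  qed
next
  show "finite (\<Union>i\<in>I. {P. ratfun_ord P (a i) \<noteq> 0})"
    by (intro finite_UN_I assms(1) finite_ratfun_ord_support)
qed


subsection \<open>Polynomials in \<open>y\<close> and \<open>y'\<close> over \<open>k(t)\<close>\<close>

text \<open>Exponents \<open>(i, j)\<close> of the terms \<open>y\<^sup>j y'\<^sup>i\<close> occurring in \<open>f\<close>.\<close>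

definition terms2 :: "'a::zero poly poly \<Rightarrow> (nat \<times> nat) set" where
  "terms2 f = {(i, j). coeff (coeff f i) j \<noteq> 0}"

lemma finite_terms2: "finite (terms2 f)"
proof (rule finite_subset)
  show "terms2 f \<subseteq> Sigma {..degree f} (\<lambda>i. {..degree (coeff f i)})"
  proof clarify
    fix i j assume "(i, j) \<in> terms2 f"
    then have "coeff (coeff f i) j \<noteq> 0" "coeff f i \<noteq> 0" by (auto simp: terms2_def)
    then show "i \<in> {..degree f} \<and> j \<in> {..degree (coeff f i)}" by (simp add: le_degree)
  qed
qed simp

definition tdeg :: "'a::zero poly poly \<Rightarrow> nat" where
  "tdeg f = Max ((\<lambda>(i, j). i + j) ` terms2 f)"

definition poly_height :: "'k::field ratfun poly poly \<Rightarrow> int" where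
  "poly_height f =
     (if card (terms2 f) = 1 then 0
      else point_height (terms2 f) (\<lambda>(i, j). coeff (coeff f i) j))"

definition ms_index :: "'a::zero poly poly \<Rightarrow> int" where
  "ms_index f =
     Max ((\<lambda>i. int (degree (coeff f i)) - 2 * (int (degree f) - int i))
          ` {i. i \<le> degree f \<and> coeff f i \<noteq> 0})"

definition eval2 :: "'a::comm_semiring_0 poly poly \<Rightarrow> 'a \<Rightarrow> 'a \<Rightarrow> 'a" where
  "eval2 f y y' = poly (map_poly (\<lambda>a. poly a y) f) y'"

definition rational_solution :: "'k::field ratfun poly poly \<Rightarrow> 'k ratfun \<Rightarrow> bool" where
  "rational_solution f r \<longleftrightarrow> eval2 f r (ratfun_deriv r) = 0"

end

theory Submission
  imports Defs
    "Berlekamp_Zassenhaus.Unique_Factorization_Poly"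
    "Subresultants.Subresultant_Gcd"
begin

text \<open>
  Give \<open>y\<close> weight 1 and \<open>y'\<close> weight 2, and let \<open>n = deg(f, y')\<close>. The hypothesis on the m.s.index says that
  the weighted degree \<open>W\<close> of \<open>f\<close> exceeds \<open>2n\<close>. Hence for large \<open>N\<close> the space of polynomials of
  weight at most \<open>N\<close> modulo \<open>f\<close>, whose dimension grows like \<open>N W / 2\<close>, is larger than \<open>n (N + 1)\<close>,
  and there is a \<open>G\<close> of weight at most \<open>N\<close>, not divisible by \<open>f\<close>, such that \<open>f(v, z)\<close> divides
  \<open>G(v, z)\<close> over \<open>k(t)\<close> for \<open>N + 1\<close> generic constants \<open>v\<close>. Counting dimensions over \<open>k\<close>
  makes the \<open>t\<close>-degree of \<open>G\<close> linear in the height of \<open>f\<close>.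

  Let \<open>r = p / q\<close> be a solution of degree \<open>d\<close>. As \<open>r'\<close> has denominator \<open>q\<^sup>2\<close>, the function
  \<open>q\<^sup>N G(r, r')\<close> is a polynomial of degree at most \<open>N d\<close> up to an error linear in the height, but up to
  a factor whose degree is linear in the height it is divisible by the \<open>N + 1\<close> pairwise coprime
  polynomials \<open>p - v q\<close> of degree \<open>d\<close>. So either \<open>d\<close> is bounded linearly in the height, or \<open>G(r, r') = 0\<close>; in
  the latter case \<open>r\<close> is a root of the resultant of \<open>f\<close> and \<open>G\<close>, which bounds \<open>d\<close> as well.
\<close>

hide_const (open) module.smult Coset.order

subsection \<open>Homogeneous linear systems and degrees of coefficients\<close>

lemma homogeneous_system_nontrivial_solution:
  fixes c :: "'e \<Rightarrow> 'u \<Rightarrow> 'a::field"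
  assumes "finite A" "finite U" "card A < card U"
  shows "\<exists>x. (\<exists>u\<in>U. x u \<noteq> 0) \<and> (\<forall>e\<in>A. (\<Sum>u\<in>U. c e u * x u) = 0)"
  using assms
proof (induction A arbitrary: c U rule: finite_induct)
  case empty
  then obtain u where "u \<in> U" by (metis card.empty ex_in_conv less_irrefl)
  then show ?case by (intro exI[of _ "\<lambda>_. 1"]) auto
next
  case (insert e A)
  show ?case
  proof (cases "\<forall>u\<in>U. c e u = 0")
    case True
    have "card A < card U" using insert by simp
    from insert.IH[OF insert.prems(1) this, of c] True show ?thesis by auto
  next
    case False
    then obtain u0 where u0: "u0 \<in> U" "c e u0 \<noteq> 0" by auto
    define U' where "U' = U - {u0}"
    have U: "U = insert u0 U'" "u0 \<notin> U'" "finite U'"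
      using u0 insert.prems by (auto simp: U'_def)
    have "card A < card U'" using insert.prems insert.hyps U by simp
    from insert.IH[OF U(3) this, of "\<lambda>e' u. c e' u - c e' u0 * c e u / c e u0"]
    obtain x where x: "\<exists>u\<in>U'. x u \<noteq> 0"
      and eq: "\<And>e'. e' \<in> A \<Longrightarrow> (\<Sum>u\<in>U'. (c e' u - c e' u0 * c e u / c e u0) * x u) = 0"
      by auto
    define x0 where "x0 = - (\<Sum>u\<in>U'. c e u * x u) / c e u0"
    define x' where "x' = x(u0 := x0)"
    have sum': "(\<Sum>u\<in>U. c e' u * x' u) = c e' u0 * x0 + (\<Sum>u\<in>U'. c e' u * x u)" for e'
    proof -
      have "(\<Sum>u\<in>U'. c e' u * x' u) = (\<Sum>u\<in>U'. c e' u * x u)"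
        using U by (intro sum.cong) (auto simp: x'_def)
      then show ?thesis using U by (simp add: x'_def)
    qed
    have "(\<Sum>u\<in>U. c e' u * x' u) = 0" if "e' \<in> insert e A" for e'
    proof (cases "e' = e")
      case True
      then show ?thesis using u0 by (simp add: sum' x0_def)
    next
      case False
      with that have "e' \<in> A" by simp
      from eq[OF this]
      have "(\<Sum>u\<in>U'. c e' u * x u) = (\<Sum>u\<in>U'. c e' u0 / c e u0 * (c e u * x u))"
        by (simp add: algebra_simps sum_subtractf)
      also have "\<dots> = - c e' u0 * x0"
        by (simp only: x0_def sum_distrib_left[symmetric]) simp
      finally show ?thesis by (simp add: sum')
    qed
    moreover have "\<exists>u\<in>U. x' u \<noteq> 0" using x U by (auto simp: x'_def)
    ultimately show ?thesis by blast
  qed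
qed

definition coeffs_degree_le :: "nat \<Rightarrow> 'a::zero poly poly \<Rightarrow> bool" where
  "coeffs_degree_le d p \<longleftrightarrow> (\<forall>i. degree (coeff p i) \<le> d)"

lemma coeffs_degree_leD: "coeffs_degree_le d p \<Longrightarrow> degree (coeff p i) \<le> d"
  by (simp add: coeffs_degree_le_def)

lemma coeffs_degree_le_mono: "coeffs_degree_le d p \<Longrightarrow> d \<le> e \<Longrightarrow> coeffs_degree_le e p"
  by (meson coeffs_degree_le_def le_trans)

lemma coeffs_degree_le_1: "coeffs_degree_le d (1 :: 'a::comm_semiring_1 poly poly)"
  by (auto simp: coeffs_degree_le_def coeff_1)

lemma coeffs_degree_le_diff:
  fixes p q :: "'a::ab_group_add poly poly"
  shows "coeffs_degree_le d p \<Longrightarrow> coeffs_degree_le d q \<Longrightarrow> coeffs_degree_le d (p - q)"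
  by (simp add: coeffs_degree_le_def degree_diff_le)

lemma coeffs_degree_le_sum:
  fixes p :: "'i \<Rightarrow> 'a::comm_monoid_add poly poly"
  assumes "\<And>i. i \<in> A \<Longrightarrow> coeffs_degree_le d (p i)"
  shows "coeffs_degree_le d (sum p A)"
  using assms
  by (induction A rule: infinite_finite_induct) (auto simp: coeffs_degree_le_def intro: degree_add_le)

lemma coeffs_degree_le_smult:
  fixes p :: "'a::comm_semiring_0 poly poly"
  assumes "degree a \<le> d" "coeffs_degree_le e p"
  shows "coeffs_degree_le (d + e) (smult a p)"
  unfolding coeffs_degree_le_def coeff_smult
  by (meson add_mono assms coeffs_degree_leD degree_mult_le le_trans)

lemma coeffs_degree_le_pCons_0:
  "coeffs_degree_le d p \<Longrightarrow> coeffs_degree_le d (pCons 0 p)"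
  by (auto simp: coeffs_degree_le_def coeff_pCons split: nat.split)

lemma coeffs_degree_le_mult:
  fixes p q :: "'a::comm_semiring_0 poly poly"
  assumes "coeffs_degree_le d p" "coeffs_degree_le e q"
  shows "coeffs_degree_le (d + e) (p * q)"
  unfolding coeffs_degree_le_def coeff_mult
  by (intro allI degree_sum_le) (auto intro: order.trans[OF degree_mult_le] add_mono assms coeffs_degree_leD)

lemma coeffs_degree_le_prod:
  fixes p :: "'i \<Rightarrow> 'a::comm_semiring_1 poly poly"
  assumes "\<And>i. i \<in> A \<Longrightarrow> coeffs_degree_le d (p i)"
  shows "coeffs_degree_le (card A * d) (prod p A)"
  using assms
  by (induction A rule: infinite_finite_induct)
    (auto simp: coeffs_degree_le_1 intro: coeffs_degree_le_mult)

lemma power_reduction: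
  fixes f :: "'a::comm_ring_1 poly poly"
  assumes "degree f \<ge> 1" "coeffs_degree_le d f"
  shows "\<exists>g. degree g < degree f \<and> coeffs_degree_le (i * d) g \<and>
           f dvd smult (lead_coeff f ^ i) (monom 1 i) - g"
proof (induction i)
  case 0
  show ?case using assms(1)
    by (intro exI[of _ 1]) (simp add: coeffs_degree_le_1 monom_0)
next
  case (Suc i)
  then obtain g where g: "degree g < degree f" "coeffs_degree_le (i * d) g"
    and dvd: "f dvd smult (lead_coeff f ^ i) (monom 1 i) - g" by blast
  define c where "c = coeff g (degree f - 1)"
  define h where "h = smult (lead_coeff f) (pCons 0 g) - smult c f"
  have "degree h \<le> degree f"
  proof -
    have "degree (pCons 0 g) \<le> degree f"
      using g(1) degree_pCons_le[of 0 g] by linarith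
    then show ?thesis unfolding h_def
      by (intro degree_diff_le order.trans[OF degree_smult_le]) auto
  qed
  moreover have "coeff h (degree f) = 0"
    using assms(1) by (cases "degree f") (simp_all add: h_def c_def mult.commute)
  ultimately have "degree h < degree f"
    using assms(1) eq_zero_or_degree_less by fastforce
  moreover have "coeffs_degree_le (Suc i * d) h"
  proof -
    have 1: "coeffs_degree_le (d + i * d) (smult (lead_coeff f) (pCons 0 g))"
      using assms(2) g(2) by (intro coeffs_degree_le_smult coeffs_degree_le_pCons_0 coeffs_degree_leD)
    have 2: "coeffs_degree_le (i * d + d) (smult c f)" unfolding c_def
      using assms(2) g(2) by (intro coeffs_degree_le_smult coeffs_degree_leD)
    from coeffs_degree_le_diff[OF 1] 2 show ?thesis by (simp add: h_def add.commute)
  qed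
  moreover have "smult (lead_coeff f ^ Suc i) (monom 1 (Suc i)) - h =
      [:0, lead_coeff f:] * (smult (lead_coeff f ^ i) (monom 1 i) - g) + smult c f"
    by (simp add: h_def monom_Suc smult_diff_right)
  then have "f dvd smult (lead_coeff f ^ Suc i) (monom 1 (Suc i)) - h"
    using dvd by (simp only: dvd_add dvd_mult dvd_smult dvd_refl)
  ultimately show ?case by blast
qed

text \<open>The leading monomial is taken for the weighted order in which \<open>y'\<close> has weight 2 and ties are
  broken in favour of the degree in \<open>y'\<close>.\<close>

lemma leading_monomial_exists:
  fixes f :: "'a::zero poly poly"
  assumes "f \<noteq> 0"
  obtains i j where "(i, j) \<in> terms2 f"
    "\<And>i' j'. (i', j') \<in> terms2 f \<Longrightarrow> 2 * i' + j' \<le> 2 * i + j"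
    "\<And>i' j'. (i', j') \<in> terms2 f \<Longrightarrow> 2 * i' + j' = 2 * i + j \<Longrightarrow> i' \<le> i"
proof -
  let ?w = "\<lambda>(i, j). 2 * i + j :: nat"
  define S where "S = {u \<in> terms2 f. ?w u = Max (?w ` terms2 f)}"
  have fin: "finite (terms2 f)" by (rule finite_terms2)
  have ne: "terms2 f \<noteq> {}"
  proof -
    from assms obtain i where "coeff f i \<noteq> 0" by (auto simp: poly_eq_iff)
    then obtain j where "coeff (coeff f i) j \<noteq> 0" by (auto simp: poly_eq_iff)
    then show ?thesis by (auto simp: terms2_def)
  qed
  have "Max (?w ` terms2 f) \<in> ?w ` terms2 f" using fin ne by (intro Max_in) auto
  then obtain u where "u \<in> terms2 f" "?w u = Max (?w ` terms2 f)" by (metis imageE)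
  then have "u \<in> S" by (simp add: S_def)
  then have "S \<noteq> {}" by auto
  moreover have "finite S" using fin by (simp add: S_def)
  ultimately have S: "S \<noteq> {}" "finite S" by auto
  from S have "Max (fst ` S) \<in> fst ` S" by (intro Max_in) auto
  then obtain i j where ij: "(i, j) \<in> S" "Max (fst ` S) = i" by auto
  show ?thesis
  proof (rule that[of i j])
    show "(i, j) \<in> terms2 f" using ij by (auto simp: S_def)
  next
    fix i' j' assume "(i', j') \<in> terms2 f"
    then have "?w (i', j') \<le> Max (?w ` terms2 f)" using fin by (intro Max_ge) auto
    then show "2 * i' + j' \<le> 2 * i + j" using ij(1) by (simp add: S_def)
  next
    fix i' j' assume "(i', j') \<in> terms2 f" "2 * i' + j' = 2 * i + j"
    then have "(i', j') \<in> S" using ij(1) by (simp add: S_def)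
    then have "i' \<in> fst ` S" by force
    then have "i' \<le> Max (fst ` S)" using S by (intro Max_ge) auto
    then show "i' \<le> i" by (simp add: ij(2))
  qed
qed

lemma leading_monomial_mult:
  fixes f g :: "'a::idom poly poly"
  assumes "(i0, j0) \<in> terms2 f"
    and W: "\<And>i j. (i, j) \<in> terms2 f \<Longrightarrow> 2 * i + j \<le> 2 * i0 + j0"
    and top: "\<And>i j. (i, j) \<in> terms2 f \<Longrightarrow> 2 * i + j = 2 * i0 + j0 \<Longrightarrow> i \<le> i0"
    and "g \<noteq> 0"
  obtains i1 j1 where "(i0 + i1, j0 + j1) \<in> terms2 (f * g)"
proof -
  obtain i1 j1 where 1: "(i1, j1) \<in> terms2 g"
    and W1: "\<And>i j. (i, j) \<in> terms2 g \<Longrightarrow> 2 * i + j \<le> 2 * i1 + j1"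
    and top1: "\<And>i j. (i, j) \<in> terms2 g \<Longrightarrow> 2 * i + j = 2 * i1 + j1 \<Longrightarrow> i \<le> i1"
    using leading_monomial_exists[OF assms(4)] by metis
  define t where "t = (\<lambda>i j. coeff (coeff f i) j * coeff (coeff g (i0 + i1 - i)) (j0 + j1 - j))"
  have zero: "t i j = 0" if "i \<le> i0 + i1" "j \<le> j0 + j1" "i \<noteq> i0 \<or> j \<noteq> j0" for i j
  proof (rule ccontr)
    assume "t i j \<noteq> 0"
    then have f: "(i, j) \<in> terms2 f" and g: "(i0 + i1 - i, j0 + j1 - j) \<in> terms2 g"
      by (auto simp: terms2_def t_def)
    have "2 * i + j = 2 * i0 + j0" "2 * (i0 + i1 - i) + (j0 + j1 - j) = 2 * i1 + j1"
      using W[OF f] W1[OF g] that by linarith+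
    moreover from this have "i \<le> i0" "i0 + i1 - i \<le> i1" using top[OF f] top1[OF g] by auto
    ultimately show False using that by linarith
  qed
  have "coeff (coeff (f * g) (i0 + i1)) (j0 + j1) = (\<Sum>i\<le>i0 + i1. \<Sum>j\<le>j0 + j1. t i j)"
    by (simp add: coeff_mult coeff_sum t_def)
  also have "\<dots> = (\<Sum>i\<in>{i0}. \<Sum>j\<le>j0 + j1. t i j)"
    by (intro sum.mono_neutral_right) (auto intro!: sum.neutral zero)
  also have "\<dots> = (\<Sum>j\<le>j0 + j1. t i0 j)" by simp
  also have "\<dots> = (\<Sum>j\<in>{j0}. t i0 j)"
    by (intro sum.mono_neutral_right) (auto intro!: zero)
  also have "\<dots> \<noteq> 0" using assms(1) 1 by (simp add: terms2_def t_def)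
  finally show ?thesis by (intro that) (simp add: terms2_def)
qed

subsection \<open>The auxiliary polynomial\<close>

lemma degree_poly_const_le:
  fixes a :: "'a::comm_semiring_1 poly poly"
  assumes "coeffs_degree_le D a"
  shows "degree (poly a [:v:]) \<le> D"
  unfolding poly_altdef
proof (rule degree_sum_le)
  fix i
  have "degree ([:v:] ^ i) = 0" using degree_power_le[of "[:v:]" i] by simp
  then show "degree (coeff a i * [:v:] ^ i) \<le> D"
    using degree_mult_le[of "coeff a i" "[:v:] ^ i"] coeffs_degree_leD[OF assms, of i] by simp
qed simp

lemma auxiliary_polynomial:
  fixes F :: "'k::field poly poly poly" and X :: "(nat \<times> nat) set"
  assumes n: "degree F \<ge> 1"
    and F: "\<And>i. coeffs_degree_le D (coeff F i)"
    and V: "finite V" "\<forall>v\<in>V. poly (lead_coeff F) [:v:] \<noteq> 0"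
    and X: "finite X" "\<forall>(i, j)\<in>X. i \<le> m" "degree F * card V < card X"
  shows "\<exists>G. G \<noteq> 0 \<and> terms2 G \<subseteq> X \<and>
    (\<forall>i. coeffs_degree_le (degree F * card V * m * D) (coeff G i)) \<and>
    (\<forall>v\<in>V. map_poly (\<lambda>a. poly a [:v:]) F dvd
       smult (poly (lead_coeff F) [:v:] ^ m) (map_poly (\<lambda>a. poly a [:v:]) G))"
proof -
  let ?n = "degree F"
  define E where "E = ?n * card V * m * D"
  define U where "U = X \<times> {..E}"
  define A where "A = V \<times> {..<?n} \<times> {..E + m * D}"
  define Fv where "Fv = (\<lambda>v. map_poly (\<lambda>a. poly a [:v:]) F)"
  define \<alpha> where "\<alpha> = (\<lambda>v. poly (lead_coeff F) [:v:])"
  have coeff_Fv: "coeff (Fv v) i = poly (coeff F i) [:v:]" for v i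
    by (simp add: Fv_def coeff_map_poly)
  have deg_Fv: "degree (Fv v) = ?n" if "v \<in> V" for v
    using V(2) that by (auto simp: Fv_def intro: degree_map_poly)
  have lead_Fv: "lead_coeff (Fv v) = \<alpha> v" if "v \<in> V" for v
    by (simp add: deg_Fv that coeff_Fv \<alpha>_def)
  have tdeg_Fv: "coeffs_degree_le D (Fv v)" for v
    unfolding coeffs_degree_le_def coeff_Fv by (intro allI degree_poly_const_le F)
  have deg_\<alpha>: "degree (\<alpha> v) \<le> D" for v
    unfolding \<alpha>_def by (rule degree_poly_const_le[OF F])
  have "\<exists>g. degree g < ?n \<and> coeffs_degree_le (i * D) g \<and>
      Fv v dvd smult (\<alpha> v ^ i) (monom 1 i) - g" if "v \<in> V" for v i
    using power_reduction[of "Fv v" D i] that n by (simp add: deg_Fv[OF that] lead_Fv[OF that, unfolded deg_Fv[OF that]] tdeg_Fv)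
  then obtain R where R: "\<And>v i. v \<in> V \<Longrightarrow> degree (R v i) < ?n"
      "\<And>v i. v \<in> V \<Longrightarrow> coeffs_degree_le (i * D) (R v i)"
      "\<And>v i. v \<in> V \<Longrightarrow> Fv v dvd smult (\<alpha> v ^ i) (monom 1 i) - R v i"
    by metis
  define b where "b = (\<lambda>v ((i, j), l). monom 1 l * [:v:] ^ j * \<alpha> v ^ (m - i))"
  define P where "P = (\<lambda>v u. smult (b v u) (R v (fst (fst u))))"
  have "card A < card U"
  proof -
    have "card A = card V * ?n * (E + m * D + 1)"
      by (simp add: A_def card_cartesian_product mult.assoc distrib_left)
    also have "\<dots> = ?n * card V * E + E + ?n * card V"
      by (simp add: E_def algebra_simps)
    also have "\<dots> < (?n * card V + 1) * (E + 1)"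
      by (simp add: algebra_simps)
    also have "\<dots> \<le> card X * (E + 1)" using X(3) by (intro mult_right_mono) auto
    also have "\<dots> = card U" by (simp add: U_def card_cartesian_product)
    finally show ?thesis .
  qed
  moreover have fin: "finite A" "finite U" using V X by (auto simp: A_def U_def)
  ultimately obtain x where x: "\<exists>u\<in>U. x u \<noteq> 0"
    and eq: "\<And>e. e \<in> A \<Longrightarrow> (\<Sum>u\<in>U. (\<lambda>(v, c, l). coeff (coeff (P v u) c) l) e * x u) = 0"
    using homogeneous_system_nontrivial_solution[of A U "\<lambda>(v, c, l) u. coeff (coeff (P v u) c) l"]
    by (auto simp: case_prod_unfold)
  have deg_P: "degree (P v u) < ?n" if "v \<in> V" for v u
    using R(1)[OF that, of "fst (fst u)"] degree_smult_le[of "b v u" "R v (fst (fst u))"]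
    by (simp add: P_def)
  have tdeg_P: "coeffs_degree_le (E + m * D) (P v u)" if "v \<in> V" "u \<in> U" for v u
  proof -
    obtain i j l where u: "u = ((i, j), l)" by (metis surj_pair)
    have i: "i \<le> m" and l: "l \<le> E" using that X(2) by (auto simp: u U_def)
    have "degree (b v u) \<le> l + 0 * j + D * (m - i)"
      unfolding b_def u prod.case
      by (intro order.trans[OF degree_mult_le] add_mono degree_monom_le
          order.trans[OF degree_power_le] mult_right_mono deg_\<alpha>) auto
    then have "coeffs_degree_le (l + D * (m - i) + i * D) (P v u)"
      unfolding P_def u using R(2)[OF that(1)] by (intro coeffs_degree_le_smult) auto
    moreover have "l + D * (m - i) + i * D \<le> E + m * D"
      using i l by (metis add.assoc add_mono_thms_linordered_semiring(3) distrib_left le_add_diff_inverse2 mult.commute)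
    ultimately show ?thesis by (rule coeffs_degree_le_mono)
  qed
  have sum_P: "(\<Sum>u\<in>U. smult [:x u:] (P v u)) = 0" if v: "v \<in> V" for v
  proof (intro poly_eqI)
    fix c l
    have 1: "coeff (coeff (\<Sum>u\<in>U. smult [:x u:] (P v u)) c) l = (\<Sum>u\<in>U. coeff (coeff (P v u) c) l * x u)"
      by (simp add: coeff_sum mult.commute)
    show "coeff (coeff (\<Sum>u\<in>U. smult [:x u:] (P v u)) c) l = coeff (coeff 0 c) l"
    proof (cases "c < ?n \<and> l \<le> E + m * D")
      case True
      with eq[of "(v, c, l)"] v show ?thesis unfolding 1 by (simp add: A_def)
    next
      case False
      have "coeff (coeff (P v u) c) l = 0" if "u \<in> U" for u
      proof (cases "c < ?n")
        case True
        with False coeffs_degree_leD[OF tdeg_P[OF v that], of c] show ?thesis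
          by (intro coeff_eq_0) auto
      next
        case False
        with deg_P[OF v, of u] show ?thesis by (simp add: coeff_eq_0)
      qed
      then show ?thesis unfolding 1 by simp
    qed
  qed
  define G where "G = (\<Sum>u\<in>U. monom (monom (monom (x u) (snd u)) (snd (fst u))) (fst (fst u)))"
  have coeff_G: "coeff (coeff (coeff G i) j) l = (if ((i, j), l) \<in> U then x ((i, j), l) else 0)" for i j l
  proof -
    have "coeff (coeff (coeff G i) j) l = (\<Sum>u\<in>U. if u = ((i, j), l) then x u else 0)"
      unfolding G_def coeff_sum by (intro sum.cong) (auto simp: coeff_monom)
    then show ?thesis using fin by simp
  qed
  show ?thesis
  proof (intro exI[of _ G] conjI allI ballI)
    show "G \<noteq> 0" using x coeff_G by (metis coeff_0 surj_pair)
    show "terms2 G \<subseteq> X"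
    proof
      fix u assume "u \<in> terms2 G"
      then obtain i j where u: "u = (i, j)" "coeff (coeff G i) j \<noteq> 0" by (auto simp: terms2_def)
      then obtain l where "coeff (coeff (coeff G i) j) l \<noteq> 0" by (metis poly_eq_iff coeff_0)
      then show "u \<in> X" unfolding coeff_G u by (auto simp: U_def split: if_splits)
    qed
    show "coeffs_degree_le (?n * card V * m * D) (coeff G i)" for i
      unfolding coeffs_degree_le_def E_def[symmetric]
      by (intro allI degree_le) (auto simp: coeff_G U_def)
    fix v assume v: "v \<in> V"
    interpret ev: map_poly_comm_ring_hom "\<lambda>a. poly a [:v:]" ..
    let ?G = "map_poly (\<lambda>a. poly a [:v:]) G"
    have "?G = (\<Sum>u\<in>U. monom (monom (x u) (snd u) * [:v:] ^ snd (fst u)) (fst (fst u)))"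
      unfolding G_def ev.hom_sum by (simp add: map_poly_monom poly_monom)
    then have "smult (\<alpha> v ^ m) ?G = (\<Sum>u\<in>U. smult (\<alpha> v ^ m)
        (monom (monom (x u) (snd u) * [:v:] ^ snd (fst u)) (fst (fst u))))"
      by (simp only: smult_sum2)
    also have "\<dots> =
        (\<Sum>u\<in>U. smult ([:x u:] * b v u) (smult (\<alpha> v ^ fst (fst u)) (monom 1 (fst (fst u)))))"
    proof (rule sum.cong[OF refl])
      fix u assume "u \<in> U"
      obtain i j l where u: "u = ((i, j), l)" by (metis surj_pair)
      have "i \<le> m" using \<open>u \<in> U\<close> X(2) by (auto simp: u U_def)
      then have "\<alpha> v ^ m = \<alpha> v ^ (m - i) * \<alpha> v ^ i" by (simp flip: power_add)
      moreover have "monom (x u) l = [:x u:] * monom 1 l" by (simp add: smult_monom)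
      ultimately show "smult (\<alpha> v ^ m) (monom (monom (x u) (snd u) * [:v:] ^ snd (fst u)) (fst (fst u)))
          = smult ([:x u:] * b v u) (smult (\<alpha> v ^ fst (fst u)) (monom 1 (fst (fst u))))"
        by (simp only: u b_def prod.case fst_conv snd_conv smult_monom smult_smult mult_1_left mult_1_right ac_simps)
    qed
    also have "\<dots> = \<dots> - (\<Sum>u\<in>U. smult [:x u:] (P v u))" by (simp only: sum_P[OF v] diff_0_right)
    also have "\<dots> = (\<Sum>u\<in>U. smult ([:x u:] * b v u)
        (smult (\<alpha> v ^ fst (fst u)) (monom 1 (fst (fst u))) - R v (fst (fst u))))"
      by (simp add: P_def sum_subtractf smult_diff_right)
    finally have *: "smult (\<alpha> v ^ m) ?G = \<dots>" .
    show "map_poly (\<lambda>a. poly a [:v:]) F dvd smult (poly (lead_coeff F) [:v:] ^ m) ?G"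
      unfolding Fv_def[symmetric, THEN fun_cong] \<alpha>_def[symmetric, THEN fun_cong] *
      by (intro dvd_sum dvd_smult R(3) v)
  qed
qed

subsection \<open>Specialisation of one variable\<close>

text \<open>The ideal generated by \<open>u\<close> in the localisation of the base ring at the powers of \<open>q\<close>.\<close>

definition local_ideal :: "'a::idom \<Rightarrow> 'a \<Rightarrow> 'a fract set" where
  "local_ideal q u = {x. \<exists>n a. x * to_fract q ^ n = to_fract (u * a)}"

lemma to_fract_power: "to_fract (x ^ n) = to_fract x ^ n"
  by (induction n) auto

lemma local_idealI: "x * to_fract q ^ n = to_fract (u * a) \<Longrightarrow> x \<in> local_ideal q u"
  by (auto simp: local_ideal_def)

lemma local_ideal_add:
  assumes "x \<in> local_ideal q u" "y \<in> local_ideal q u"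
  shows "x + y \<in> local_ideal q u"
proof -
  from assms obtain m a n b where "x * to_fract q ^ m = to_fract (u * a)"
    "y * to_fract q ^ n = to_fract (u * b)" by (auto simp: local_ideal_def)
  moreover have "(x + y) * to_fract q ^ (m + n) =
      x * to_fract q ^ m * to_fract q ^ n + y * to_fract q ^ n * to_fract q ^ m"
    by (simp add: algebra_simps power_add)
  ultimately have "(x + y) * to_fract q ^ (m + n) = to_fract (u * (a * q ^ n + b * q ^ m))"
    by (simp add: algebra_simps to_fract_power)
  then show ?thesis by (rule local_idealI)
qed

lemma local_ideal_mult:
  assumes "x \<in> local_ideal q u" "y \<in> local_ideal q 1"
  shows "x * y \<in> local_ideal q u"
proof -
  from assms obtain m a n b where "x * to_fract q ^ m = to_fract (u * a)"
    "y * to_fract q ^ n = to_fract b" by (auto simp: local_ideal_def)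
  moreover have "(x * y) * to_fract q ^ (m + n) = (x * to_fract q ^ m) * (y * to_fract q ^ n)"
    by (simp add: algebra_simps power_add)
  ultimately have "(x * y) * to_fract q ^ (m + n) = to_fract (u * (a * b))"
    by simp
  then show ?thesis by (rule local_idealI)
qed

lemma local_ideal_to_fract: "to_fract a \<in> local_ideal q 1"
  by (rule local_idealI[of _ _ 0 _ a]) simp

lemma local_ideal_diff:
  assumes "x \<in> local_ideal q u" "y \<in> local_ideal q u"
  shows "x - y \<in> local_ideal q u"
  using local_ideal_add[OF assms(1) local_ideal_mult[OF assms(2) local_ideal_to_fract[of "- 1"]]]
  by (simp only: to_fract_uminus to_fract_1 mult_minus_right mult_1_right diff_conv_add_uminus)

lemma local_ideal_0: "0 \<in> local_ideal q u"
  by (rule local_idealI[of _ _ 0 _ 0]) simp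

lemma poly_local_ideal:
  assumes "x \<in> local_ideal q 1"
  shows "poly (map_poly to_fract a) x \<in> local_ideal q 1"
proof (induction a)
  case (pCons c a)
  then show ?case using local_ideal_add[OF local_ideal_to_fract local_ideal_mult[OF assms pCons(2)]]
    by (simp add: Polynomial.map_poly_pCons)
qed (simp add: local_ideal_0)

lemma poly_diff_local_ideal:
  assumes "x \<in> local_ideal q 1" "x - to_fract v \<in> local_ideal q u"
  shows "poly (map_poly to_fract a) x - to_fract (poly a v) \<in> local_ideal q u"
proof (induction a)
  case (pCons c a)
  have "poly (map_poly to_fract (pCons c a)) x - to_fract (poly (pCons c a) v) =
    (poly (map_poly to_fract a) x - to_fract (poly a v)) * x + (x - to_fract v) * to_fract (poly a v)"
    by (simp add: Polynomial.map_poly_pCons algebra_simps)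
  also have "\<dots> \<in> local_ideal q u"
    by (intro local_ideal_add local_ideal_mult local_ideal_to_fract pCons.IH assms)
  finally show ?case .
qed (simp add: local_ideal_0)

abbreviation eval_fract2 :: "'a::idom poly poly \<Rightarrow> 'a fract \<Rightarrow> 'a fract \<Rightarrow> 'a fract" where
  "eval_fract2 F x y \<equiv> eval2 (map_poly (map_poly to_fract) F) x y"

lemma eval_fract2_altdef:
  "eval_fract2 F x y = poly (map_poly (\<lambda>a. poly (map_poly to_fract a) x) F) y"
  by (simp add: eval2_def map_poly_map_poly o_def)

lemma eval_fract2_pCons:
  "eval_fract2 (pCons a F) x y = poly (map_poly to_fract a) x + y * eval_fract2 F x y"
  unfolding eval_fract2_altdef by (simp add: Polynomial.map_poly_pCons)

lemma eval_fract2_diff_local_ideal: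
  assumes "x \<in> local_ideal q 1" "x - to_fract v \<in> local_ideal q u" "y \<in> local_ideal q 1"
  shows "eval_fract2 F x y - poly (map_poly to_fract (map_poly (\<lambda>a. poly a v) F)) y \<in> local_ideal q u"
proof (induction F)
  case (pCons a F)
  have "eval_fract2 (pCons a F) x y - poly (map_poly to_fract (map_poly (\<lambda>a. poly a v) (pCons a F))) y =
    (poly (map_poly to_fract a) x - to_fract (poly a v)) +
    (eval_fract2 F x y - poly (map_poly to_fract (map_poly (\<lambda>a. poly a v) F)) y) * y"
    unfolding eval_fract2_pCons by (simp add: Polynomial.map_poly_pCons algebra_simps)
  also have "\<dots> \<in> local_ideal q u"
    by (intro local_ideal_add local_ideal_mult poly_diff_local_ideal pCons.IH assms)
  finally show ?case .
qed (simp add: local_ideal_0 eval2_def)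

lemma coprime_dvd_mult_power:
  fixes u q c :: "'k::field poly"
  assumes "Rings.coprime u q" "u \<noteq> 0" "u dvd q ^ n * c"
  shows "u dvd c"
  using assms(3)
proof (induction n)
  case (Suc n)
  then have "u dvd q * (q ^ n * c)" by (simp add: mult.assoc)
  moreover have "Rings.coprime q u" using assms(1) Rings.coprime_commute[of u q] by simp
  ultimately have "u dvd q ^ n * c" using assms(2) field_poly_coprime_dvd_mult by blast
  with Suc show ?case by simp
qed simp

lemma specialised_multiple_dvd:
  fixes p q w :: "'k::field poly" and F G :: "'k poly poly poly"
  defines "x \<equiv> to_fract p / to_fract q" and "y \<equiv> to_fract w / to_fract q ^ 2"
  assumes "q \<noteq> 0" and cop: "Rings.coprime (p - v * q) q" "p - v * q \<noteq> 0"
    and dvd: "map_poly (\<lambda>a. poly a v) F dvd smult \<beta> (map_poly (\<lambda>a. poly a v) G)"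
    and F0: "eval_fract2 F x y = 0"
    and A: "eval_fract2 G x y * to_fract q ^ N = to_fract A"
  shows "p - v * q dvd \<beta> * A"
proof -
  let ?u = "p - v * q"
  let ?h = "\<lambda>F. poly (map_poly to_fract F) y :: 'k poly fract"
  let ?s = "map_poly (\<lambda>a. poly a v)"
  have x: "x \<in> local_ideal q 1" using \<open>q \<noteq> 0\<close>
    by (intro local_idealI[of _ _ 1 _ p]) (simp add: x_def)
  have xv: "x - to_fract v \<in> local_ideal q ?u" using \<open>q \<noteq> 0\<close>
    by (intro local_idealI[of _ _ 1 _ 1]) (simp add: x_def field_simps)
  have y: "y \<in> local_ideal q 1" using \<open>q \<noteq> 0\<close>
    by (intro local_idealI[of _ _ 2 _ w]) (simp add: y_def)
  from dvd obtain T where T: "smult \<beta> (?s G) = ?s F * T" by (rule dvdE)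
  have "?h (?s F) \<in> local_ideal q ?u"
    using local_ideal_diff[OF local_ideal_0 eval_fract2_diff_local_ideal[OF x xv y, of F]] F0 by simp
  then have "?h (?s F) * ?h T \<in> local_ideal q ?u"
    by (rule local_ideal_mult) (rule poly_local_ideal[OF y])
  moreover have "?h (?s F) * ?h T = to_fract \<beta> * ?h (?s G)"
    using arg_cong[OF T, of ?h] by simp
  ultimately have "to_fract \<beta> * ?h (?s G) \<in> local_ideal q ?u" by simp
  moreover have "(eval_fract2 G x y - ?h (?s G)) * to_fract \<beta> \<in> local_ideal q ?u"
    by (intro local_ideal_mult eval_fract2_diff_local_ideal x xv y local_ideal_to_fract)
  ultimately have "to_fract \<beta> * ?h (?s G) + (eval_fract2 G x y - ?h (?s G)) * to_fract \<beta> \<in> local_ideal q ?u"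
    by (rule local_ideal_add)
  then have "to_fract \<beta> * eval_fract2 G x y \<in> local_ideal q ?u" by (simp add: algebra_simps)
  then have "to_fract \<beta> * eval_fract2 G x y * to_fract (q ^ N) \<in> local_ideal q ?u"
    by (rule local_ideal_mult) (rule local_ideal_to_fract)
  then have "to_fract (\<beta> * A) \<in> local_ideal q ?u" using A by (simp add: to_fract_power mult.assoc)
  then obtain n a where "to_fract (\<beta> * A) * to_fract q ^ n = to_fract (?u * a)"
    by (auto simp: local_ideal_def)
  then have "q ^ n * (\<beta> * A) = ?u * a"
    by (metis mult.commute to_fract_eq_iff to_fract_mult to_fract_power)
  then have "?u dvd q ^ n * (\<beta> * A)" by simp
  then show ?thesis by (rule coprime_dvd_mult_power[OF cop])
qed

lemma root_degree_le:
  fixes p q :: "'k::field poly" and S :: "'k poly poly"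
  assumes "q \<noteq> 0" "Rings.coprime (p - v * q) q" "p - v * q \<noteq> 0"
    and "poly (map_poly to_fract S) (to_fract p / to_fract q) = 0" "poly S v \<noteq> 0"
  shows "degree (p - v * q) \<le> degree (poly S v)"
proof -
  have "p - v * q dvd 1 * poly S v"
  proof (rule specialised_multiple_dvd[where w = 0 and F = "[:S:]" and G = "[:[:poly S v:]:]" and N = 0, OF assms(1-3)])
  qed (use assms(4) in \<open>simp_all add: eval2_def Polynomial.map_poly_pCons\<close>)
  then show ?thesis using assms(5) by (intro dvd_imp_degree_le) auto
qed

lemma coprime_dvd_prod_mult:
  fixes u :: "'k::field poly" and b :: "'i \<Rightarrow> 'k poly"
  assumes "finite W" "u \<noteq> 0" "\<And>w. w \<in> W \<Longrightarrow> Rings.coprime u (b w)" "u dvd prod b W * c"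
  shows "u dvd c"
  using assms(1,3,4)
proof (induction W rule: finite_induct)
  case (insert w W)
  then have "u dvd b w * (prod b W * c)" by (simp add: mult.assoc)
  have "Rings.coprime (b w) u" using insert.prems(1)[of w] Rings.coprime_commute[of u "b w"] by simp
  from this \<open>u dvd b w * (prod b W * c)\<close> have "u dvd prod b W * c" by (rule field_poly_coprime_dvd_mult[OF _ assms(2)])
  then show ?case using insert.prems(1) by (intro insert.IH) auto
qed simp

lemma pairwise_coprime_prod_dvd:
  fixes u \<beta> :: "'i \<Rightarrow> 'k::field poly"
  assumes "finite V"
    and "\<And>v. v \<in> V \<Longrightarrow> u v dvd \<beta> v * A" "\<And>v. v \<in> V \<Longrightarrow> u v \<noteq> 0"
    and "\<And>v v'. v \<in> V \<Longrightarrow> v' \<in> V \<Longrightarrow> v \<noteq> v' \<Longrightarrow> Rings.coprime (u v) (u v')"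
  shows "prod u V dvd prod \<beta> V * A"
  using assms
proof (induction V rule: finite_induct)
  case (insert v V)
  then have "prod u V dvd prod \<beta> V * A" by simp
  then obtain B where B: "prod \<beta> V * A = prod u V * B" by (rule dvdE)
  have eq: "prod \<beta> V * (\<beta> v * A) = prod u V * (\<beta> v * B)"
    by (simp only: mult.left_commute[of _ "\<beta> v"] B)
  have "u v dvd prod \<beta> V * (\<beta> v * A)" by (intro dvd_mult insert.prems(1)) simp
  then have "u v dvd prod u V * (\<beta> v * B)" by (simp only: eq)
  moreover have "Rings.coprime (u v) (u w)" if "w \<in> V" for w
  proof (rule insert.prems(3))
    show "v \<noteq> w" using insert.hyps(2) that by metis
  qed (use that in simp_all)
  ultimately have "u v dvd \<beta> v * B"
    using insert.hyps(1) insert.prems(2)[of v] coprime_dvd_prod_mult[of V "u v" u] by blast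
  then have "prod u V * u v dvd prod u V * (\<beta> v * B)" by (rule mult_dvd_mono[OF dvd_refl])
  then have "u v * prod u V dvd \<beta> v * prod \<beta> V * A"
    unfolding eq[symmetric] by (simp only: ac_simps)
  then show ?case by (simp only: prod.insert[OF insert.hyps])
qed simp

lemma degree_minus_smult_max:
  fixes p q :: "'k::field poly"
  assumes "coeff p (max (degree p) (degree q)) \<noteq> v * coeff q (max (degree p) (degree q))"
  shows "degree (p - smult v q) = max (degree p) (degree q)"
proof (rule antisym)
  show "degree (p - smult v q) \<le> max (degree p) (degree q)"
    by (rule degree_diff_le) (auto intro: le_max_iff_disj[THEN iffD2] degree_smult_le)
  show "max (degree p) (degree q) \<le> degree (p - smult v q)"
    by (rule le_degree) (use assms in simp)
qed

lemma generic_constants: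
  fixes p q :: "'k::field_char_0 poly" and a :: "'k poly poly"
  assumes "q \<noteq> 0" "a \<noteq> 0"
  obtains V where "finite V" "card V = n"
    "\<And>v. v \<in> V \<Longrightarrow> poly a [:v:] \<noteq> 0"
    "\<And>v. v \<in> V \<Longrightarrow> degree (p - [:v:] * q) = max (degree p) (degree q)"
proof -
  let ?d = "max (degree p) (degree q)"
  have "finite {v. poly a [:v:] = 0}"
  proof (rule finite_imageD)
    show "finite ((\<lambda>v. [:v:]) ` {v. poly a [:v:] = 0})"
      by (rule finite_subset[OF _ poly_roots_finite[OF assms(2)]]) auto
  qed (auto intro: inj_onI)
  moreover have "finite {v. coeff p ?d = v * coeff q ?d}"
  proof (cases "coeff q ?d = 0")
    case True
    have "coeff p ?d \<noteq> 0"
      using assms(1) True by (cases "degree p \<le> degree q") auto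
    with True show ?thesis by simp
  next
    case False
    then have "{v. coeff p ?d = v * coeff q ?d} \<subseteq> {coeff p ?d / coeff q ?d}" by auto
    then show ?thesis by (rule finite_subset) simp
  qed
  ultimately have "infinite (- ({v. poly a [:v:] = 0} \<union> {v. coeff p ?d = v * coeff q ?d}))"
    by (simp add: Compl_eq_Diff_UNIV Diff_infinite_finite infinite_UNIV_char_0)
  then obtain V where "finite V" "card V = n"
    "V \<subseteq> - ({v. poly a [:v:] = 0} \<union> {v. coeff p ?d = v * coeff q ?d})"
    using infinite_arbitrarily_large by blast
  then show ?thesis
    by (intro that[of V]) (auto intro!: degree_minus_smult_max)
qed

lemma poly_map_poly_sum:
  fixes f :: "'a::zero \<Rightarrow> 'b::comm_semiring_1"
  assumes "f 0 = 0" "degree p \<le> n"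
  shows "poly (map_poly f p) x = (\<Sum>i\<le>n. f (coeff p i) * x ^ i)"
proof -
  have "degree (map_poly f p) \<le> n" using degree_map_poly_le[of f p] assms(2) by linarith
  then have "poly (map_poly f p) x = (\<Sum>i\<le>n. coeff (map_poly f p) i * x ^ i)"
    unfolding poly_altdef by (intro sum.mono_neutral_left) (auto simp: coeff_eq_0)
  then show ?thesis by (simp add: coeff_map_poly assms(1))
qed

lemma eval_fract2_numerator:
  fixes p q w :: "'a::idom poly" and G :: "'a poly poly poly"
  assumes "q \<noteq> 0" and N: "\<And>i j. (i, j) \<in> terms2 G \<Longrightarrow> j + 2 * i \<le> N"
    and E: "\<And>i. coeffs_degree_le E (coeff G i)"
    and d: "degree p \<le> d" "degree q \<le> d" "degree w \<le> 2 * d"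
  obtains A where "degree A \<le> E + N * d"
    "eval_fract2 G (to_fract p / to_fract q) (to_fract w / to_fract q ^ 2) * to_fract q ^ N = to_fract A"
proof -
  define t where "t = (\<lambda>i j. coeff (coeff G i) j * (p ^ j * w ^ i * q ^ (N - j - 2 * i)))"
  define A where "A = (\<Sum>i\<le>degree G. \<Sum>j\<le>degree (coeff G i). t i j)"
  let ?x = "to_fract p / to_fract q" and ?y = "to_fract w / to_fract q ^ 2"
  have t: "to_fract (coeff (coeff G i) j) * ?x ^ j * ?y ^ i * to_fract q ^ N = to_fract (t i j)" for i j
  proof (cases "coeff (coeff G i) j = 0")
    case False
    then have "j + 2 * i \<le> N" using N by (simp add: terms2_def)
    then have "N = j + (2 * i + (N - j - 2 * i))" by simp
    then have "to_fract q ^ N = to_fract q ^ j * ((to_fract q ^ 2) ^ i * to_fract q ^ (N - j - 2 * i))"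
      by (metis power_add power_mult)
    then show ?thesis using assms(1)
      by (simp add: t_def to_fract_power power_divide)
  qed (simp add: t_def)
  have "degree (t i j) \<le> E + N * d" for i j
  proof (cases "coeff (coeff G i) j = 0")
    case False
    then have "j + 2 * i \<le> N" using N by (simp add: terms2_def)
    then obtain k where "N = j + 2 * i + k" using le_Suc_ex by blast
    then have eq: "d * j + 2 * d * i + d * (N - j - 2 * i) = N * d"
      by (simp add: algebra_simps)
    have "degree (t i j) \<le> E + (d * j + 2 * d * i + d * (N - j - 2 * i))"
      unfolding t_def
      by (intro order.trans[OF degree_mult_le] add_mono order.trans[OF degree_power_le]
          mult_right_mono coeffs_degree_leD E d) auto
    then show ?thesis by (simp only: eq)
  qed (simp add: t_def)
  then have "degree A \<le> E + N * d"
    unfolding A_def by (intro degree_sum_le) auto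
  moreover have "eval_fract2 G ?x ?y * to_fract q ^ N = to_fract A"
  proof -
    have "eval_fract2 G ?x ?y = (\<Sum>i\<le>degree G. poly (map_poly to_fract (coeff G i)) ?x * ?y ^ i)"
      unfolding eval_fract2_altdef by (rule poly_map_poly_sum) simp_all
    moreover have "poly (map_poly to_fract (coeff G i)) ?x =
        (\<Sum>j\<le>degree (coeff G i). to_fract (coeff (coeff G i) j) * ?x ^ j)" for i
      by (rule poly_map_poly_sum) simp_all
    ultimately have "eval_fract2 G ?x ?y * to_fract q ^ N = (\<Sum>i\<le>degree G. \<Sum>j\<le>degree (coeff G i).
        to_fract (coeff (coeff G i) j) * ?x ^ j * ?y ^ i * to_fract q ^ N)"
      by (simp only: sum_distrib_right)
    then show ?thesis by (simp only: t A_def to_fract_sum)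
  qed
  ultimately show ?thesis by (rule that)
qed

subsection \<open>Elimination\<close>

lemma sylvester_mat_coeff:
  fixes F G :: "'a::comm_ring_1 poly"
  defines "d \<equiv> degree F + degree G"
  assumes "i < d"
  obtains a H where "H \<in> {F, G}" "a + degree H < d"
    "\<And>j. j < d \<Longrightarrow> sylvester_mat F G $$ (i, j) = coeff (monom 1 a * H) (d - 1 - j)"
proof (cases "i < degree G")
  case True
  show ?thesis
  proof (rule that[of F "degree G - 1 - i"])
    show "sylvester_mat F G $$ (i, j) = coeff (monom 1 (degree G - 1 - i) * F) (d - 1 - j)" if "j < d" for j
      using assms that True by (auto simp: sylvester_index_mat2 coeff_monom_mult intro!: arg_cong[of _ _ "coeff F"])
  qed (use True in \<open>auto simp: d_def\<close>)
next
  case False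
  show ?thesis
  proof (rule that[of G "d - 1 - i"])
    show "sylvester_mat F G $$ (i, j) = coeff (monom 1 (d - 1 - i) * G) (d - 1 - j)" if "j < d" for j
      using assms that False by (auto simp: sylvester_index_mat2 coeff_monom_mult intro!: arg_cong[of _ _ "coeff G"])
  qed (use False assms in auto)
qed

lemma resultant_common_root:
  fixes h :: "'a::comm_ring_1 \<Rightarrow> 'b::idom"
  assumes "comm_ring_hom h" "poly (map_poly h F) s = 0" "poly (map_poly h G) s = 0"
    and d: "degree F + degree G > 0"
  shows "h (resultant F G) = 0"
proof -
  interpret h: comm_ring_hom h by (rule assms(1))
  interpret hp: map_poly_comm_ring_hom h ..
  let ?d = "degree F + degree G"
  let ?M = "sylvester_mat F G"
  define v where "v = vec ?d (\<lambda>j. s ^ (?d - 1 - j))"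
  have M: "map_mat h ?M \<in> carrier_mat ?d ?d" using sylvester_carrier_mat[of F G] by simp
  have "v $ (?d - 1) \<noteq> 0\<^sub>v ?d $ (?d - 1)" using d by (simp add: v_def)
  then have "v \<noteq> 0\<^sub>v ?d" by auto
  moreover have "map_mat h ?M *\<^sub>v v = 0\<^sub>v ?d"
  proof (rule eq_vecI)
    fix i assume "i < dim_vec (0\<^sub>v ?d :: 'b vec)"
    then have i: "i < ?d" by simp
    obtain a H where H: "H \<in> {F, G}" "a + degree H < ?d"
      and entry: "\<And>j. j < ?d \<Longrightarrow> ?M $$ (i, j) = coeff (monom 1 a * H) (?d - 1 - j)"
      by (rule sylvester_mat_coeff[OF i], rule that)
    have "(map_mat h ?M *\<^sub>v v) $ i = (\<Sum>j<?d. h (?M $$ (i, j)) * s ^ (?d - 1 - j))"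
      using i M by (simp add: v_def scalar_prod_def lessThan_atLeast0)
    also have "\<dots> = (\<Sum>j<?d. h (coeff (monom 1 a * H) (?d - Suc j)) * s ^ (?d - Suc j))"
      by (intro sum.cong) (auto simp: entry)
    also have "\<dots> = (\<Sum>k<?d. h (coeff (monom 1 a * H) k) * s ^ k)"
      by (rule sum.nat_diff_reindex)
    also have "\<dots> = (\<Sum>k\<le>?d - 1. h (coeff (monom 1 a * H) k) * s ^ k)"
      using d by (intro sum.cong) auto
    also have "\<dots> = poly (map_poly h (monom 1 a * H)) s"
      using H(2) degree_mult_le[of "monom 1 a" H] degree_monom_le[of "1::'a" a]
      by (intro poly_map_poly_sum[symmetric]) auto
    also have "\<dots> = 0" using H(1) assms(2,3) by (auto simp: hp.hom_mult)
    finally show "(map_mat h ?M *\<^sub>v v) $ i = 0\<^sub>v ?d $ i" using i by simp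
  qed simp
  moreover have "v \<in> carrier_vec ?d" by (simp add: v_def)
  ultimately have "det (map_mat h ?M) = 0" using det_0_iff_vec_prod_zero[OF M] by blast
  then show ?thesis by (simp add: resultant_def)
qed

lemma resultant_coeffs_degree_le:
  fixes F G :: "'a::comm_ring_1 poly poly poly"
  assumes "\<And>i. coeffs_degree_le e (coeff F i)" "\<And>i. coeffs_degree_le e (coeff G i)"
  shows "coeffs_degree_le ((degree F + degree G) * e) (resultant F G)"
proof -
  let ?d = "degree F + degree G"
  have zero: "coeffs_degree_le e (0 :: 'a poly poly)" by (simp add: coeffs_degree_le_def)
  have entry: "coeffs_degree_le e (sylvester_mat F G $$ (i, j))" if "i < ?d" "j < ?d" for i j
    using that by (simp add: sylvester_index_mat assms zero)
  have "coeffs_degree_le (?d * e)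
      (signof \<pi> * (\<Prod>i = 0..<?d. sylvester_mat F G $$ (i, \<pi> i)))" if "\<pi> permutes {0..<?d}" for \<pi>
  proof -
    have "coeffs_degree_le (card {0..<?d} * e) (\<Prod>i = 0..<?d. sylvester_mat F G $$ (i, \<pi> i))"
      using permutes_in_image[OF that] by (intro coeffs_degree_le_prod entry) auto
    then show ?thesis using signof_pm_one[of \<pi>]
      by (auto simp: sign_def coeffs_degree_le_def)
  qed
  then show ?thesis
    unfolding resultant_def det_def'[OF sylvester_carrier_mat] by (intro coeffs_degree_le_sum) auto
qed

lemma coprime_diff_mult:
  fixes p q c :: "'k::field poly"
  assumes "Rings.coprime p q"
  shows "Rings.coprime (p - c * q) q"
proof (rule Rings.coprimeI)
  fix d assume "d dvd p - c * q" "d dvd q"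
  then have "d dvd p - c * q + c * q" by (intro dvd_add dvd_mult)
  then have "d dvd p" by simp
  from Rings.coprime_common_divisor[OF assms this \<open>d dvd q\<close>] show "is_unit d" .
qed

lemma coprime_diff_mult_diff_mult:
  fixes p q :: "'k::field poly"
  assumes "Rings.coprime p q" "a \<noteq> b"
  shows "Rings.coprime (p - [:a:] * q) (p - [:b:] * q)"
proof (rule Rings.coprimeI)
  fix d assume d: "d dvd p - [:a:] * q" "d dvd p - [:b:] * q"
  then have "d dvd [:inverse (b - a):] * ((p - [:a:] * q) - (p - [:b:] * q))"
    by (rule dvd_mult[OF dvd_diff])
  also have "\<dots> = q" using assms(2)
    by (simp add: smult_diff_left[symmetric])
  finally have "d dvd q" .
  from Rings.coprime_common_divisor[OF coprime_diff_mult[OF assms(1)] d(1) this] show "is_unit d" .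
qed

lemma common_zero_degree_le:
  fixes p q :: "'k::field_char_0 poly" and F G :: "'k poly poly poly"
  defines "x \<equiv> to_fract p / to_fract q"
  assumes "q \<noteq> 0" "Rings.coprime p q" "resultant F G \<noteq> 0" "degree F \<ge> 1"
    and e: "\<And>i. coeffs_degree_le e (coeff F i)" "\<And>i. coeffs_degree_le e (coeff G i)"
    and zero: "eval_fract2 F x y = 0" "eval_fract2 G x y = 0"
  shows "max (degree p) (degree q) \<le> (degree F + degree G) * e"
proof -
  let ?S = "resultant F G" and ?d = "max (degree p) (degree q)"
  have "comm_ring_hom (\<lambda>a. poly (map_poly to_fract a) x)"
    by unfold_locales simp_all
  from resultant_common_root[OF this] have S: "poly (map_poly to_fract ?S) x = 0"
    using assms(5) zero by (simp add: eval_fract2_altdef)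
  obtain V where V: "card V = 1"
    "\<And>v. v \<in> V \<Longrightarrow> poly ?S [:v:] \<noteq> 0" "\<And>v. v \<in> V \<Longrightarrow> degree (p - [:v:] * q) = ?d"
    using generic_constants[OF assms(2,4), of 1 p] by metis
  then obtain v where v: "poly ?S [:v:] \<noteq> 0" "degree (p - [:v:] * q) = ?d"
    by (metis card_1_singletonE singletonI)
  show ?thesis
  proof (cases "?d = 0")
    case False
    then have "p - [:v:] * q \<noteq> 0" using v(2) by (metis degree_0)
    from root_degree_le[OF assms(2) coprime_diff_mult[OF assms(3)] this S[unfolded x_def] v(1)]
    have "?d \<le> degree (poly ?S [:v:])" by (simp only: v(2))
    also have "\<dots> \<le> (degree F + degree G) * e"
      by (intro degree_poly_const_le resultant_coeffs_degree_le e)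
    finally show ?thesis .
  qed simp
qed

subsection \<open>Heights\<close>

lemma clear_denominators:
  fixes g :: "'a::idom fract poly"
  shows "\<exists>b h. b \<noteq> 0 \<and> smult (to_fract b) g = map_poly to_fract h"
proof (induction g)
  case 0
  show ?case by (intro exI[of _ 1] exI[of _ 0]) simp
next
  case (pCons a g)
  then obtain b h where b: "b \<noteq> 0" "smult (to_fract b) g = map_poly to_fract h" by blast
  obtain u v where a: "a = to_fract u / to_fract v" "v \<noteq> 0"
    by (cases a) (auto simp: Fract_conv_to_fract)
  have "smult (to_fract (v * b)) (pCons a g) = map_poly to_fract (pCons (b * u) (smult v h))"
    using a(2) b(2) by (simp add: Polynomial.map_poly_pCons a(1) smult_smult[symmetric] del: smult_smult)
  moreover have "v * b \<noteq> 0" using a b by simp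
  ultimately show ?case by blast
qed

lemma clear_denominators2:
  fixes f :: "'a::idom fract poly poly"
  shows "\<exists>b F. b \<noteq> 0 \<and> smult [:to_fract b:] f = map_poly (map_poly to_fract) F"
proof (induction f)
  case 0
  show ?case by (intro exI[of _ 1] exI[of _ 0]) simp
next
  case (pCons g f)
  then obtain b F where b: "b \<noteq> 0" "smult [:to_fract b:] f = map_poly (map_poly to_fract) F" by blast
  obtain v h where v: "v \<noteq> 0" "smult (to_fract v) g = map_poly to_fract h"
    using clear_denominators by blast
  have "smult [:to_fract (v * b):] f = smult [:to_fract v:] (smult [:to_fract b:] f)"
    by (simp add: mult.commute)
  also have "\<dots> = map_poly (map_poly to_fract) (smult [:v:] F)"
    unfolding b(2) by (intro poly_eqI) (simp add: coeff_map_poly)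
  finally have 1: "smult [:to_fract (v * b):] f = map_poly (map_poly to_fract) (smult [:v:] F)" .
  have "smult (to_fract (v * b)) g = smult (to_fract b) (smult (to_fract v) g)"
    by (simp add: mult.commute)
  also have "\<dots> = map_poly to_fract (smult b h)" unfolding v(2) by simp
  finally have 2: "smult (to_fract (v * b)) g = map_poly to_fract (smult b h)" .
  have "smult [:to_fract (v * b):] (pCons g f) =
      map_poly (map_poly to_fract) (pCons (smult b h) (smult [:v:] F))"
    using 1 2 by (simp add: Polynomial.map_poly_pCons)
  moreover have "v * b \<noteq> 0" using v b by simp
  ultimately show ?case by blast
qed

lemma coprime_coefficients:
  fixes f :: "'k::field ratfun poly poly"
  assumes "f \<noteq> 0"
  obtains c F where "c \<noteq> 0" "f = smult [:c:] (map_poly (map_poly to_fract) F)"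
    "\<And>x. \<exists>i j. poly (coeff (coeff F i) j) x \<noteq> 0"
proof -
  define P where "P = (\<lambda>(c, F). c \<noteq> 0 \<and> f = smult [:c:] (map_poly (map_poly to_fract) F))"
  from assms obtain i where "coeff f i \<noteq> 0" by (auto simp: poly_eq_iff)
  then obtain j where ij: "coeff (coeff f i) j \<noteq> 0" by (auto simp: poly_eq_iff)
  obtain b F0 where b: "b \<noteq> 0" "smult [:to_fract b:] f = map_poly (map_poly to_fract) F0"
    using clear_denominators2 by blast
  have "f = smult [:inverse (to_fract b):] (map_poly (map_poly to_fract) F0)"
    using b(1) by (simp add: b(2)[symmetric])
  then have "P (inverse (to_fract b), F0)" using b(1) by (simp add: P_def)
  then obtain u where u: "P u"
    and min: "\<And>u'. P u' \<Longrightarrow> degree (coeff (coeff (snd u) i) j) \<le> degree (coeff (coeff (snd u') i) j)"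
    using ex_has_least_nat[of P _ "\<lambda>u. degree (coeff (coeff (snd u) i) j)"] by blast
  obtain c F where u_eq: "u = (c, F)" by (cases u)
  have cF: "c \<noteq> 0" "f = smult [:c:] (map_poly (map_poly to_fract) F)" using u by (simp_all add: P_def u_eq)
  have "\<exists>i j. poly (coeff (coeff F i) j) x \<noteq> 0" for x
  proof (rule ccontr)
    assume "\<nexists>i j. poly (coeff (coeff F i) j) x \<noteq> 0"
    then have "[:-x, 1:] dvd coeff (coeff F i) j" for i j by (simp add: poly_eq_0_iff_dvd)
    then have "[:[:[:-x, 1:]:]:] dvd F" by (simp add: const_poly_dvd_iff)
    then obtain F' where F': "F = smult [:[:-x, 1:]:] F'" by (auto elim!: dvdE)
    have "f = smult [:c * to_fract [:-x, 1:]:] (map_poly (map_poly to_fract) F')"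
      unfolding cF(2) F' by (intro poly_eqI) (simp add: coeff_map_poly)
    then have "P (c * to_fract [:-x, 1:], F')" using cF(1) by (simp add: P_def)
    from min[OF this] have le: "degree (coeff (coeff F i) j) \<le> degree (coeff (coeff F' i) j)"
      by (simp add: u_eq)
    have eq: "coeff (coeff F i) j = [:-x, 1:] * coeff (coeff F' i) j" by (simp add: F')
    have "coeff (coeff F' i) j \<noteq> 0"
      using ij by (auto simp: cF(2) coeff_map_poly F')
    then have "degree (coeff (coeff F i) j) = Suc (degree (coeff (coeff F' i) j))"
      unfolding eq by (subst degree_mult_eq) auto
    with le show False by simp
  qed
  with cF show ?thesis by (rule that)
qed

lemma sum_order_alg_closed:
  fixes p :: "'k::alg_closed_field poly"
  assumes "p \<noteq> 0"
  shows "(\<Sum>x | poly p x = 0. order x p) = degree p"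
proof -
  obtain A where A: "size A = degree p" "p = smult (lead_coeff p) (\<Prod>x\<in>#A. [:-x, 1:])"
    using alg_closed_imp_factorization[OF assms] by blast
  have "proots p = proots (\<Prod>x\<in>#A. [:-x, 1:])"
    using assms by (subst A(2)) simp
  also have "\<dots> = A"
  proof (induction A)
    case (add x A)
    have "(\<Prod>x\<in>#A. [:-x, 1:]) \<noteq> 0" by (auto simp: prod_mset_zero_iff)
    then have "proots ([:-x, 1:] * (\<Prod>x\<in>#A. [:-x, 1:])) = proots [:-x, 1:] + proots (\<Prod>x\<in>#A. [:-x, 1:])"
      by (intro proots_mult) (simp del: mult_pCons_left)
    also have "\<dots> = add_mset x A" by (simp only: proots_linear_factor add.IH) simp
    finally show ?case by (simp del: mult_pCons_left)
  qed simp
  finally have "size (proots p) = degree p" using A(1) by simp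
  then show ?thesis using assms by (simp add: size_multiset_overloaded_eq)
qed

lemma Sum_any_poly_ord:
  fixes p :: "'k::alg_closed_field poly"
  assumes "p \<noteq> 0"
  shows "finite {P. poly_ord P p \<noteq> 0}" "Sum_any (\<lambda>P. poly_ord P p) = 0"
proof -
  let ?R = "{x. poly p x = 0}"
  let ?S = "insert Infinite_place (Finite_place ` ?R)"
  have fin: "finite ?R" using assms by (rule poly_roots_finite)
  have sub: "{P. poly_ord P p \<noteq> 0} \<subseteq> ?S"
  proof
    fix P assume "P \<in> {P. poly_ord P p \<noteq> 0}"
    with assms show "P \<in> ?S" by (cases P) (auto simp: order_root)
  qed
  then show "finite {P. poly_ord P p \<noteq> 0}" by (rule finite_subset) (simp add: fin)
  have "Sum_any (\<lambda>P. poly_ord P p) = (\<Sum>P\<in>?S. poly_ord P p)"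
    using fin sub by (intro Sum_any.expand_superset) auto
  also have "\<dots> = - int (degree p) + (\<Sum>x\<in>?R. int (order x p))"
    using fin by (subst sum.insert) (auto simp: sum.reindex inj_on_def)
  also have "\<dots> = 0"
    using sum_order_alg_closed[OF assms] by (simp flip: of_nat_sum)
  finally show "Sum_any (\<lambda>P. poly_ord P p) = 0" .
qed

lemma ratfun_ord_mult_to_fract:
  assumes "c \<noteq> 0" "p \<noteq> 0"
  shows "ratfun_ord P (c * to_fract p) = ratfun_ord P c + poly_ord P p"
proof -
  obtain a b where "c = Fraction_Field.Fract a b" "b \<noteq> 0" "a \<noteq> 0"
    using assms(1) by (cases c rule: Fract_cases_nonzero) auto
  then show ?thesis using assms(2) by (simp add: to_fract_def ratfun_ord_Fract poly_ord_mult)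
qed

lemma product_formula:
  fixes c :: "'k::alg_closed_field ratfun"
  assumes "c \<noteq> 0"
  shows "Sum_any (\<lambda>P. ratfun_ord P c) = 0"
proof -
  obtain a b where c: "c = Fraction_Field.Fract a b" "b \<noteq> 0" "a \<noteq> 0"
    using assms by (cases c rule: Fract_cases_nonzero) auto
  have "Sum_any (\<lambda>P. ratfun_ord P c + poly_ord P b) = Sum_any (\<lambda>P. ratfun_ord P c) + Sum_any (\<lambda>P. poly_ord P b)"
    using c by (intro Sum_any.distrib finite_ratfun_ord_support Sum_any_poly_ord)
  moreover have "ratfun_ord P c + poly_ord P b = poly_ord P a" for P
    using c by (simp add: ratfun_ord_Fract)
  ultimately show ?thesis using Sum_any_poly_ord(2)[OF c(2)] Sum_any_poly_ord(2)[OF c(3)] by simp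
qed

lemma degree_le_poly_height:
  fixes F :: "'k::alg_closed_field poly poly poly"
  assumes "c \<noteq> 0" and f: "f = smult [:c:] (map_poly (map_poly to_fract) F)"
    and root: "\<And>x. \<exists>i j. poly (coeff (coeff F i) j) x \<noteq> 0"
  shows "int (degree (coeff (coeff F i) j)) \<le> poly_height f"
proof -
  let ?I = "terms2 F"
  let ?a = "\<lambda>(i, j). coeff (coeff F i) j"
  have coeff_f: "coeff (coeff f i) j = c * to_fract (coeff (coeff F i) j)" for i j
    by (simp add: f coeff_map_poly)
  have I: "terms2 f = ?I" using assms(1) by (simp add: terms2_def coeff_f)
  have fin: "finite ?I" by (rule finite_terms2)
  have root': "\<exists>u\<in>?I. poly (?a u) x \<noteq> 0" for x
    using root[of x] by (force simp: terms2_def)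
  then have ne: "?I \<noteq> {}" by blast
  define D where "D = Max ((\<lambda>u. int (degree (?a u))) ` ?I)"
  have le_D: "int (degree (coeff (coeff F i) j)) \<le> D" for i j
  proof (cases "(i, j) \<in> ?I")
    case True
    have "int (degree (?a (i, j))) \<le> D" unfolding D_def using fin True by (intro Max_ge) blast+
    then show ?thesis by simp
  next
    case False
    obtain u where "u \<in> ?I" using ne by blast
    then have "int (degree (?a u)) \<le> D" unfolding D_def using fin by (intro Max_ge) blast+
    with False show ?thesis by (simp add: terms2_def)
  qed
  have "D = poly_height f"
  proof (cases "card ?I = 1")
    case True
    then obtain u where u: "?I = {u}" by (rule card_1_singletonE)
    have "degree (?a u) = 0"
    proof (rule ccontr)
      assume "degree (?a u) \<noteq> 0"
      then obtain x where "poly (?a u) x = 0" using alg_closed_imp_poly_has_root by blast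
      with root'[of x] show False by (simp add: u)
    qed
    then show ?thesis using True by (simp add: poly_height_def I D_def u)
  next
    case False
    have max: "Max ((\<lambda>u. - ratfun_ord P (case u of (i, j) \<Rightarrow> coeff (coeff f i) j))
          ` {u \<in> ?I. (case u of (i, j) \<Rightarrow> coeff (coeff f i) j) \<noteq> 0}) =
        - ratfun_ord P c + (if P = Infinite_place then D else 0)" for P
    proof -
      have "{u \<in> ?I. (case u of (i, j) \<Rightarrow> coeff (coeff f i) j) \<noteq> 0} = ?I"
        using assms(1) by (auto simp: coeff_f terms2_def)
      moreover have "- ratfun_ord P (case u of (i, j) \<Rightarrow> coeff (coeff f i) j) =
          - ratfun_ord P c - poly_ord P (?a u)" if "u \<in> ?I" for u
        using that assms(1) by (auto simp: coeff_f terms2_def ratfun_ord_mult_to_fract)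
      ultimately have "(\<lambda>u. - ratfun_ord P (case u of (i, j) \<Rightarrow> coeff (coeff f i) j))
          ` {u \<in> ?I. (case u of (i, j) \<Rightarrow> coeff (coeff f i) j) \<noteq> 0} =
          (\<lambda>u. - ratfun_ord P c - poly_ord P (?a u)) ` ?I" by simp
      moreover have "Max ((\<lambda>u. - ratfun_ord P c - poly_ord P (?a u)) ` ?I) =
          - ratfun_ord P c + (if P = Infinite_place then D else 0)"
      proof (cases P)
        case (Finite_place x)
        obtain u where u: "u \<in> ?I" "poly (?a u) x \<noteq> 0" using root' by blast
        then have "order x (?a u) = 0" by (intro order_0I)
        then have *: "- ratfun_ord P c = - ratfun_ord P c - poly_ord P (?a u)"
          by (simp add: Finite_place)
        show ?thesis
        proof (rule Max_eqI)
          show "- ratfun_ord P c + (if P = Infinite_place then D else 0) \<in>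
             (\<lambda>u. - ratfun_ord P c - poly_ord P (?a u)) ` ?I"
            by (rule image_eqI[OF _ u(1)]) (use * in \<open>simp add: Finite_place\<close>)
        qed (use fin in \<open>auto simp: Finite_place\<close>)
      next
        case Infinite_place
        have "D \<in> (\<lambda>u. int (degree (?a u))) ` ?I" unfolding D_def using fin ne by (intro Max_in) auto
        then obtain u where u: "u \<in> ?I" "D = int (degree (?a u))" by (rule imageE)
        show ?thesis
        proof (rule Max_eqI)
          show "- ratfun_ord P c + (if P = Infinite_place then D else 0) \<in>
             (\<lambda>u. - ratfun_ord P c - poly_ord P (?a u)) ` ?I"
            by (rule image_eqI[OF _ u(1)]) (use u(2) in \<open>simp add: Infinite_place\<close>)
        qed (use fin le_D in \<open>auto simp: Infinite_place\<close>)
      qed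
      ultimately show ?thesis by simp
    qed
    have supp: "finite {P. - ratfun_ord P c \<noteq> 0}"
      using finite_ratfun_ord_support[of c] by simp
    have "Sum_any (\<lambda>P. - ratfun_ord P c) = 0"
      using product_formula[OF assms(1)] by (simp add: Sum_any.expand_set sum_negf)
    moreover have "Sum_any (\<lambda>P :: 'k place. if P = Infinite_place then D else 0) = D"
      by (subst Sum_any.expand_superset[of "{Infinite_place}"]) auto
    moreover have "Sum_any (\<lambda>P. - ratfun_ord P c + (if P = Infinite_place then D else 0)) =
        Sum_any (\<lambda>P. - ratfun_ord P c) + Sum_any (\<lambda>P :: 'k place. if P = Infinite_place then D else 0)"
      by (rule Sum_any.distrib[OF supp]) simp
    ultimately have "Sum_any (\<lambda>P. - ratfun_ord P c + (if P = Infinite_place then D else 0)) = D"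
      by simp
    then show ?thesis using False by (simp add: poly_height_def I point_height_def max)
  qed
  with le_D show ?thesis by simp
qed

subsection \<open>The degree bound\<close>

lemma resultant_nonzero:
  fixes F G :: "'k::field poly poly poly"
  assumes "irreducible (map_poly (map_poly to_fract) F)"
    and "\<not> map_poly (map_poly to_fract) F dvd map_poly (map_poly to_fract) G"
  shows "resultant F G \<noteq> 0"
proof
  interpret E: map_poly_inj_comm_ring_hom "to_fract :: 'k poly \<Rightarrow> 'k ratfun" ..
  let ?F = "map_poly (map_poly to_fract) F" and ?G = "map_poly (map_poly to_fract) G"
  assume "resultant F G = 0"
  then have "resultant ?F ?G = 0" by (simp add: E.resultant_hom)
  then have deg: "degree (gcd ?F ?G) \<noteq> 0" by (simp add: resultant_0_gcd)
  have "\<not> gcd ?F ?G dvd 1"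
  proof
    assume "gcd ?F ?G dvd 1"
    then obtain c where "gcd ?F ?G = [:c:]" by (auto simp only: is_unit_poly_iff)
    with deg show False by simp
  qed
  then have "?F dvd gcd ?F ?G"
    using irreducibleD'[OF assms(1) gcd_dvd1] by blast
  then have "?F dvd ?G" by (rule dvd_trans) (rule gcd_dvd2)
  with assms(2) show False by blast
qed

text \<open>Exponents of bounded weight whose monomials are not divisible by the leading monomial
  \<open>(i0, j0)\<close> of \<open>f\<close>, so that a nonzero polynomial supported on them is not a multiple of \<open>f\<close>.\<close>

definition staircase :: "nat \<Rightarrow> nat \<Rightarrow> nat \<Rightarrow> (nat \<times> nat) set" where
  "staircase i0 j0 b = {..<i0} \<times> {..<2 * b} \<union> {i0..<i0 + b} \<times> {..<j0}"

lemma card_staircase: "card (staircase i0 j0 b) = b * (2 * i0 + j0)"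
proof -
  have "card (staircase i0 j0 b) = card ({..<i0} \<times> {..<2 * b}) + card ({i0..<i0 + b} \<times> {..<j0})"
    unfolding staircase_def by (rule card_Un_disjoint) auto
  then show ?thesis by (simp add: card_cartesian_product algebra_simps)
qed

lemma staircase_bounds:
  assumes "(i, j) \<in> staircase i0 j0 b"
  shows "i \<le> i0 + b" "j + 2 * i \<le> 2 * i0 + j0 + 2 * b" "\<not> (i0 \<le> i \<and> j0 \<le> j)"
  using assms by (auto simp: staircase_def)

lemma finite_staircase: "finite (staircase i0 j0 b)"
  by (simp add: staircase_def)

lemma degree_bound_aux:
  fixes n W i0 b N m x :: nat
  assumes x: "x \<ge> 2" "n \<le> x" "W \<le> x" "2 * n + 1 \<le> W" "i0 \<le> W"
    and b: "b = n * (W + 1) + 1" and N: "N = W + 2 * b" and m: "m = i0 + b"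
  shows "(n + m) * (n * (N + 1) * m) \<le> x ^ 15"
proof -
  have pw: "x ^ k * 2 \<le> x ^ Suc k" for k using x(1) by simp
  have "b \<le> x ^ 2 * 2"
  proof -
    have "n * (W + 1) \<le> x * (x + 1)" using x by (intro mult_mono) auto
    moreover have "1 + x \<le> x * x" using x(1) mult_le_mono[OF x(1) order_refl, of x] by linarith
    ultimately show ?thesis unfolding b by (simp add: power2_eq_square)
  qed
  then have b3: "b \<le> x ^ 3" using pw[of 2] by (simp add: eval_nat_numeral)
  have x3: "x \<le> x ^ 3" "1 \<le> x ^ 3" "x ^ 3 * 2 \<le> x ^ 4" "x ^ 4 * 2 \<le> x ^ 5" "x \<le> x ^ 4"
    using x(1) pw[of 3] pw[of 4] by (simp_all add: self_le_power eval_nat_numeral)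
  have m4: "m \<le> x ^ 4" using m b3 x x3 by linarith
  have N5: "N + 1 \<le> x ^ 5" using N b3 x x3 by linarith
  have "n + m \<le> x ^ 4 * 2" using x x3 m4 by linarith
  then have nm: "n + m \<le> x ^ 5" using x3 by linarith
  have "(n + m) * (n * (N + 1) * m) \<le> x ^ 5 * (x * x ^ 5 * x ^ 4)"
    using nm N5 m4 x by (intro mult_mono) auto
  also have "\<dots> = x ^ 15" by (simp flip: power_add power_Suc)
  finally show ?thesis .
qed


lemma degree_le_of_weighted_zero:
  fixes F :: "'k::field_char_0 poly poly poly" and p q w :: "'k poly"
  defines "d \<equiv> max (degree p) (degree q)"
  assumes irr: "irreducible (map_poly (map_poly to_fract) F)"
    and n: "degree F \<ge> 1"
    and D: "\<And>i. coeffs_degree_le D (coeff F i)"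
    and \<rho>: "\<And>i j. (i, j) \<in> terms2 F \<Longrightarrow> i + j \<le> \<rho>"
    and big: "\<exists>(i, j) \<in> terms2 F. 2 * degree F + 1 \<le> 2 * i + j"
    and pq: "q \<noteq> 0" "Rings.coprime p q" and w: "degree w \<le> 2 * d"
    and zero: "eval_fract2 F (to_fract p / to_fract q) (to_fract w / to_fract q ^ 2) = 0"
  shows "d \<le> (2 * \<rho>) ^ 15 * D"
proof -
  let ?E = "map_poly (map_poly to_fract) :: 'k poly poly poly \<Rightarrow> 'k ratfun poly poly"
  let ?x = "to_fract p / to_fract q" and ?y = "to_fract w / to_fract q ^ 2"
  have terms_E: "terms2 (?E H) = terms2 H" for H by (simp add: terms2_def coeff_map_poly)
  have F0: "F \<noteq> 0" using n by auto
  define n where "n = degree F"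
  obtain i0 j0 where ij0: "(i0, j0) \<in> terms2 F"
    "\<And>i j. (i, j) \<in> terms2 F \<Longrightarrow> 2 * i + j \<le> 2 * i0 + j0"
    "\<And>i j. (i, j) \<in> terms2 F \<Longrightarrow> 2 * i + j = 2 * i0 + j0 \<Longrightarrow> i \<le> i0"
    using leading_monomial_exists[OF F0] by metis
  define W where "W = 2 * i0 + j0"
  define b where "b = n * (W + 1) + 1"
  define N where "N = W + 2 * b"
  define m where "m = i0 + b"
  define M where "M = n * (N + 1) * m"
  have W: "2 * n + 1 \<le> W" using big ij0(2) by (force simp: n_def W_def)
  have n1: "n \<ge> 1" using n by (simp add: n_def)
  have m1: "m \<ge> 1" by (simp add: m_def b_def)
  have bound: "(n + m) * M \<le> (2 * \<rho>) ^ 15"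
    unfolding M_def
  proof (rule degree_bound_aux[OF _ _ _ W _ b_def N_def m_def])
    have "W \<le> 2 * \<rho>" using \<rho>[OF ij0(1)] by (simp add: W_def)
    with W n1 show "2 \<le> 2 * \<rho>" "n \<le> 2 * \<rho>" "W \<le> 2 * \<rho>" by linarith+
    show "i0 \<le> W" by (simp add: W_def)
  qed
  have "lead_coeff F \<noteq> 0" using F0 by simp
  then obtain V where V: "finite V" "card V = N + 1"
    "\<And>v. v \<in> V \<Longrightarrow> poly (lead_coeff F) [:v:] \<noteq> 0"
    "\<And>v. v \<in> V \<Longrightarrow> degree (p - [:v:] * q) = d"
    using generic_constants[OF pq(1), of "lead_coeff F" "N + 1" p] by (metis d_def)
  define X where "X = staircase i0 j0 b"
  have "b * W = b * (W - 1) + b" using W by (cases W) simp_all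
  moreover have "b * (2 * n) \<le> b * (W - 1)" using W by (intro mult_left_mono) auto
  ultimately have "n * (N + 1) < b * W"
    unfolding N_def by (simp add: b_def algebra_simps)
  then have card: "degree F * card V < card X"
    by (simp add: X_def card_staircase V(2) n_def W_def)
  have X: "finite X" "\<forall>(i, j)\<in>X. i \<le> m"
    using staircase_bounds(1) by (auto simp: X_def m_def finite_staircase)
  obtain G where G: "G \<noteq> 0" "terms2 G \<subseteq> X"
    "\<And>i. coeffs_degree_le (degree F * card V * m * D) (coeff G i)"
    "\<And>v. v \<in> V \<Longrightarrow> map_poly (\<lambda>a. poly a [:v:]) F dvd
       smult (poly (lead_coeff F) [:v:] ^ m) (map_poly (\<lambda>a. poly a [:v:]) G)"
    using auxiliary_polynomial[OF n D V(1) _ X card] V(3) by blast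
  have E: "degree F * card V * m * D = M * D" by (simp add: M_def V(2) n_def)
  have notdvd: "\<not> ?E F dvd ?E G"
  proof
    assume "?E F dvd ?E G"
    then obtain T where T: "?E G = ?E F * T" by (rule dvdE)
    have "?E G \<noteq> 0" using G(1) by (simp add: map_poly_eq_0_iff)
    then have "T \<noteq> 0" using T by auto
    with ij0 obtain i1 j1 where "(i0 + i1, j0 + j1) \<in> terms2 (?E F * T)"
      unfolding terms_E[of F, symmetric] by (rule leading_monomial_mult)
    then have "(i0 + i1, j0 + j1) \<in> X" using G(2) by (auto simp: terms_E T[symmetric])
    then show False using staircase_bounds(3) by (fastforce simp: X_def)
  qed
  have "j + 2 * i \<le> N" if "(i, j) \<in> terms2 G" for i j
    using staircase_bounds(2)[of i j i0 j0 b] that G(2) by (auto simp: X_def N_def W_def)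
  then obtain A where A: "degree A \<le> M * D + N * d"
    "eval_fract2 G ?x ?y * to_fract q ^ N = to_fract A"
    using eval_fract2_numerator[OF pq(1), of G N "M * D" p d w] G(3) w by (auto simp: d_def E)
  show ?thesis
  proof (cases "A = 0")
    case True
    then have "eval_fract2 G ?x ?y = 0" using A(2) pq(1) by simp
    moreover have "coeffs_degree_le (M * D) (coeff F i)" for i
    proof (rule coeffs_degree_le_mono[OF D])
      have "M \<ge> 1" using n1 m1 by (simp add: M_def)
      then show "D \<le> M * D" by simp
    qed
    ultimately have "d \<le> (degree F + degree G) * (M * D)"
      unfolding d_def using common_zero_degree_le[OF pq resultant_nonzero[OF irr notdvd] n, of "M * D"] G(3) zero
      by (simp add: E)
    also have "degree G \<le> m"
    proof (rule degree_le, intro allI impI)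
      fix i assume "m < i"
      then have "(i, j) \<notin> terms2 G" for j
        using G(2) staircase_bounds(1)[of i j i0 j0 b] by (auto simp: X_def m_def)
      then show "coeff G i = 0" by (auto simp: terms2_def poly_eq_iff)
    qed
    then have "(degree F + degree G) * (M * D) \<le> (n + m) * (M * D)"
      by (intro mult_right_mono) (auto simp: n_def)
    also have "\<dots> = (n + m) * M * D" by (simp only: mult.assoc)
    also have "\<dots> \<le> (2 * \<rho>) ^ 15 * D" using bound by (rule mult_right_mono) simp
    finally show ?thesis .
  next
    case A0: False
    show ?thesis
    proof (cases "d = 0")
      case d0: False
      define u where "u = (\<lambda>v. p - [:v:] * q)"
      define \<beta> where "\<beta> = (\<lambda>v. poly (lead_coeff F) [:v:] ^ m)"
      have u: "degree (u v) = d" "u v \<noteq> 0" if "v \<in> V" for v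
        using V(4)[OF that] d0 by (auto simp: u_def)
      have \<beta>: "\<beta> v \<noteq> 0" "degree (\<beta> v) \<le> m * D" if "v \<in> V" for v
      proof -
        show "\<beta> v \<noteq> 0" using V(3)[OF that] by (simp add: \<beta>_def)
        have "degree (\<beta> v) \<le> degree (poly (lead_coeff F) [:v:]) * m"
          unfolding \<beta>_def by (rule degree_power_le)
        also have "\<dots> \<le> D * m" by (intro mult_right_mono degree_poly_const_le D) simp
        finally show "degree (\<beta> v) \<le> m * D" by (simp add: mult.commute)
      qed
      have "prod u V dvd prod \<beta> V * A"
      proof (rule pairwise_coprime_prod_dvd[OF V(1)])
        fix v assume v: "v \<in> V"
        show "u v dvd \<beta> v * A" unfolding u_def \<beta>_def
          using u(2)[OF v, unfolded u_def]
          by (rule specialised_multiple_dvd[OF pq(1) coprime_diff_mult[OF pq(2)] _ G(4)[OF v] zero A(2)])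
      qed (use u coprime_diff_mult_diff_mult[OF pq(2)] in \<open>auto simp: u_def\<close>)
      moreover have "prod \<beta> V * A \<noteq> 0" using \<beta> A0 V(1) by simp
      ultimately have "degree (prod u V) \<le> degree (prod \<beta> V * A)" by (rule dvd_imp_degree_le)
      moreover have "degree (prod u V) = (N + 1) * d"
        using u V(1,2) by (simp add: degree_prod_eq_sum_degree)
      moreover have "degree (prod \<beta> V * A) \<le> (N + 1) * (m * D) + (M * D + N * d)"
      proof (rule order.trans[OF degree_mult_le add_mono[OF _ A(1)]])
        have "degree (prod \<beta> V) \<le> (\<Sum>v\<in>V. degree (\<beta> v))"
          using degree_prod_sum_le[OF V(1), of \<beta>] by (simp add: o_def)
        also have "\<dots> \<le> card V * (m * D)" using sum_bounded_above[of V "\<lambda>v. degree (\<beta> v)" "m * D"] \<beta>(2) by simp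
        finally show "degree (prod \<beta> V) \<le> (N + 1) * (m * D)" by (simp only: V(2))
      qed
      ultimately have "d \<le> (N + 1) * (m * D) + M * D" by simp
      also have "\<dots> = ((N + 1) * m + M) * D" by (simp add: algebra_simps)
      also have "\<dots> \<le> (n + m) * M * D"
      proof (rule mult_right_mono)
        have "1 * (N + 1) * m \<le> M" unfolding M_def using n1 by (intro mult_right_mono) simp_all
        then have "(N + 1) * m + M \<le> (1 + 1) * M" by simp
        also have "\<dots> \<le> (n + m) * M" using n1 m1 by (intro mult_right_mono add_mono) auto
        finally show "(N + 1) * m + M \<le> (n + m) * M" .
      qed simp
      also have "\<dots> \<le> (2 * \<rho>) ^ 15 * D" using bound by (rule mult_right_mono) simp
      finally show ?thesis .
    qed simp
  qed
qed

theorem theorem3p3: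
  fixes f :: "'k::{alg_closed_field, field_char_0} poly fract poly poly"
    and r :: "'k poly fract"
  assumes "irreducible f"
    and "degree f \<ge> 1"
    and "ms_index f > 0"
    and "rational_solution f r"
    and "ratfun_degree r \<ge> 1"
  shows "int (ratfun_degree r) \<le> (2 * int (tdeg f)) ^ ((2 * tdeg f) ^ 15) * poly_height f"
proof -
  let ?E = "map_poly (map_poly to_fract) :: 'k poly poly poly \<Rightarrow> 'k ratfun poly poly"
  have "f \<noteq> 0" using assms(2) by auto
  then obtain c F where c: "c \<noteq> 0" and f: "f = smult [:c:] (?E F)"
    and root: "\<And>x. \<exists>i j. poly (coeff (coeff F i) j) x \<noteq> 0"
    by (rule coprime_coefficients) blast
  have coeff_f: "coeff (coeff f i) j = c * to_fract (coeff (coeff F i) j)" for i j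
    by (simp add: f coeff_map_poly)
  have terms: "terms2 f = terms2 F" using c by (simp add: terms2_def coeff_f)
  have "degree (?E F) = degree F" by (rule degree_map_poly) simp
  then have deg: "degree f = degree F" using c by (simp add: f)
  have "is_unit [:[:c:]:]" using c by (simp add: is_unit_const_poly_iff)
  moreover have "f = [:[:c:]:] * ?E F" by (simp add: f)
  ultimately have irr: "irreducible (?E F)" using assms(1) by (simp only: irreducible_mult_unit_left)
  obtain p q where pq: "q \<noteq> 0" "Rings.coprime p q" "r = Fraction_Field.Fract p q"
    by (rule ratfun_coprime_cases)
  let ?d = "max (degree p) (degree q)"
  let ?w = "pderiv p * q - p * pderiv q"
  have d: "ratfun_degree r = ?d" using pq by (simp add: ratfun_degree_Fract)
  define D where "D = nat (poly_height f)"
  have height: "int (degree (coeff (coeff F i) j)) \<le> poly_height f" for i j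
    using c f root by (rule degree_le_poly_height)
  then have D: "int D = poly_height f" unfolding D_def by (smt (verit) of_nat_0_le_iff nat_0_le)
  have "?d \<le> (2 * tdeg f) ^ 15 * D"
  proof (rule degree_le_of_weighted_zero[OF irr _ _ _ _ pq(1,2)])
    show "degree F \<ge> 1" using assms(2) deg by simp
    show "coeffs_degree_le D (coeff F i)" for i
      unfolding coeffs_degree_le_def using height[of i, folded D] by simp
    show "i + j \<le> tdeg f" if "(i, j) \<in> terms2 F" for i j
      unfolding tdeg_def terms using that finite_terms2[of F] by (intro Max_ge) force+
    show "\<exists>(i, j)\<in>terms2 F. 2 * degree F + 1 \<le> 2 * i + j"
    proof -
      let ?I = "{i. i \<le> degree f \<and> coeff f i \<noteq> 0}"
      let ?h = "\<lambda>i. int (degree (coeff f i)) - 2 * (int (degree f) - int i)"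
      have "degree f \<in> ?I" using \<open>f \<noteq> 0\<close> by simp
      then have "Max (?h ` ?I) \<in> ?h ` ?I" by (intro Max_in) auto
      then obtain i where i: "i \<in> ?I" "?h i > 0" using assms(3) unfolding ms_index_def by auto
      then have "(i, degree (coeff f i)) \<in> terms2 F"
        unfolding terms[symmetric] by (simp add: terms2_def)
      moreover have "2 * degree F + 1 \<le> 2 * i + degree (coeff f i)" using i(2) deg by arith
      ultimately show ?thesis by blast
    qed
    show "degree ?w \<le> 2 * ?d"
    proof (rule degree_diff_le)
      show "degree (pderiv p * q) \<le> 2 * ?d"
        using degree_mult_le[of "pderiv p" q] degree_pderiv[of p] by simp
      show "degree (p * pderiv q) \<le> 2 * ?d"
        using degree_mult_le[of p "pderiv q"] degree_pderiv[of q] by simp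
    qed
    have r: "r = to_fract p / to_fract q" by (simp add: pq(3) Fract_conv_to_fract)
    have r': "ratfun_deriv r = to_fract ?w / to_fract q ^ 2"
      unfolding pq(3) ratfun_deriv_Fract[OF pq(1)] by (simp add: Fract_conv_to_fract power2_eq_square)
    have "eval2 f r y = c * eval_fract2 F r y" for y
    proof -
      have "map_poly (\<lambda>a. poly a r) f = smult c (map_poly (\<lambda>a. poly a r) (?E F))"
        unfolding f by (intro poly_eqI) (simp add: coeff_map_poly)
      then show ?thesis by (simp add: eval2_def)
    qed
    then show "eval_fract2 F (to_fract p / to_fract q) (to_fract ?w / to_fract q ^ 2) = 0"
      using assms(4) c unfolding rational_solution_def r' unfolding r by simp
  qed
  then have "int ?d \<le> int ((2 * tdeg f) ^ 15 * D)" by (simp only: of_nat_le_iff)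
  then have "int (ratfun_degree r) \<le> (2 * int (tdeg f)) ^ 15 * poly_height f"
    by (simp only: d D[symmetric] of_nat_mult of_nat_power of_nat_numeral)
  also have "\<dots> \<le> (2 * int (tdeg f)) ^ ((2 * tdeg f) ^ 15) * poly_height f"
  proof (rule mult_right_mono)
    show "(2 * int (tdeg f)) ^ 15 \<le> (2 * int (tdeg f)) ^ ((2 * tdeg f) ^ 15)"
    proof (cases "tdeg f = 0")
      case False
      have "(15::nat) \<le> 2 ^ 15" by simp
      also have "(2::nat) ^ 15 \<le> (2 * tdeg f) ^ 15" using False by (intro power_mono) auto
      finally show ?thesis using False by (intro power_increasing) auto
    qed simp
  qed (use D in linarith)
  finally show ?thesis .
qed

end
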